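(* Let $(\mathfrak g,\delta,[-,-],\mathcal F)$ be a complete filtered DGLA over a field of characteristic zero satisfying $\delta(\mathcal F^r)\subseteq\mathcal F^{r+1}$ and $[\mathcal F^r,\mathcal F^s]\subseteq\mathcal F^{r+s}$, and let $k\ge4$. Let $m^{(0)},m^{(1)},m^{(2)}\in\mathcal F^2\mathfrak g^1$ be Maurer--Cartan elements. Suppose that $p\in\mathcal P_{k-1}(m^{(0)},m^{(1)})$ and $q\in\mathcal P_{k-1}(m^{(1)},m^{(2)})$. Define $q*p=\operatorname{BCH}(q,p)$, so that $\Gamma_{q*p}=\Gamma_q\circ\Gamma_p$. Then $q*p\in\mathcal P_{k-1}(m^{(0)},m^{(2)})$ and $$\widetilde\kappa_k(q*p;m^{(0)},m^{(2)})=\widetilde\kappa_k(p;m^{(0)},m^{(1)})+\widetilde\kappa_k(q;m^{(1)},m^{(2)})$$ in $\operatorname{gr}_{\mathcal F}^{k-1}\mathfrak g^1$.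
   Context: $\mathcal F$ is a decreasing filtration $\mathfrak g=\mathcal F^1\mathfrak g\supseteq\mathcal F^2\mathfrak g\supseteq\cdots$ with $\mathfrak g\cong\varprojlim_p\mathfrak g/\mathcal F^p\mathfrak g$; superscripts on $\mathfrak g$ outside $\mathcal F$ denote degree, and $\operatorname{gr}_{\mathcal F}^r\mathfrak g=\mathcal F^r\mathfrak g/\mathcal F^{r+1}\mathfrak g$. A Maurer--Cartan element is $m\in\mathfrak g^1$ with $\delta m+\frac12[m,m]=0$. For $p\in\mathcal F^1\mathfrak g^0$ the gauge action is $\Gamma_p(x)=e^{\operatorname{ad}_p}*x=e^{\operatorname{ad}_p}(x)-\sum_{j\ge0}\frac{(\operatorname{ad}_p)^j}{(j+1)!}(\delta p)$, and $\operatorname{BCH}$ is the Baker--Campbell--Hausdorff product on $\mathcal F^1\mathfrak g^0$. For Maurer--Cartan elements $m,m'\in\mathcal F^2\mathfrak g^1$, $\mathcal P_{k-1}(m,m')=\{p\in\mathcal F^1\mathfrak g^0:e^{\operatorname{ad}_p}*m-m'\in\mathcal F^{k-1}\mathfrak g\}$, and for $p\in\mathcal P_{k-1}(m,m')$, $\widetilde\kappa_k(p;m,m')$ denotes the class of $e^{\operatorname{ad}_p}*m-m'$ in $\operatorname{gr}_{\mathcal F}^{k-1}\mathfrak g$. (In the application $\mathfrak g$ is the Harrison DGLA controlling minimal $C_\infty$-algebra enhancements of a graded commutative algebra, filtered by shifted arity.) *)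

theory Defs
  imports Complex_Main "HOL-Library.FuncSet" "HOL-Library.Set_Algebras"
begin

text \<open>
  The underlying vector space of the DGLA is the whole type \<open>'g\<close>, over the field \<open>'k\<close> acting by
  \<open>scal\<close>. It is the internal direct sum of the homogeneous parts \<open>Deg L n\<close>, where \<open>n\<close> is an
  integer. \<open>Fil L r\<close> is meaningful for \<open>r \<ge> 1\<close> only; nothing is assumed about \<open>Fil L 0\<close>.
\<close>

record ('k, 'g) filtered_dgla =
  scal :: "'k \<Rightarrow> 'g \<Rightarrow> 'g"
  Deg :: "int \<Rightarrow> 'g set"
  dif :: "'g \<Rightarrow> 'g"
  brk :: "'g \<Rightarrow> 'g \<Rightarrow> 'g"
  Fil :: "nat \<Rightarrow> 'g set"

definition FD :: "('k, 'g) filtered_dgla \<Rightarrow> nat \<Rightarrow> int \<Rightarrow> 'g set" where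
  "FD L r n = Fil L r \<inter> Deg L n"

text \<open>
  The quotient of \<open>Deg L n\<close> by \<open>FD L r n\<close> is the set of cosets \<open>x +o FD L r n\<close>; on cosets, the
  projection to the quotient by \<open>FD L r n\<close> is \<open>A \<mapsto> A + FD L r n\<close>, a Minkowski sum.
\<close>

definition quotients :: "('k, 'g::ab_group_add) filtered_dgla \<Rightarrow> nat \<Rightarrow> int \<Rightarrow> 'g set set" where
  "quotients L r n = (\<lambda>x. x +o FD L r n) ` Deg L n"

definition inverse_limit :: "('k, 'g::ab_group_add) filtered_dgla \<Rightarrow> int \<Rightarrow> (nat \<Rightarrow> 'g set) set" where
  "inverse_limit L n =
     {c \<in> (\<Pi>\<^sub>E r\<in>{1..}. quotients L r n). \<forall>r\<ge>1. c (Suc r) + FD L r n = c r}"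

locale complete_filtered_dgla =
  fixes L :: "('k::field_char_0, 'g::ab_group_add) filtered_dgla"
  assumes vector_space: "vector_space (scal L)"
    and Deg_subspace: "module.subspace (scal L) (Deg L n)"
    and Deg_direct_sum:
      "\<exists>!c. (\<forall>n. c n \<in> Deg L n) \<and> finite {n. c n \<noteq> 0} \<and> x = (\<Sum>n | c n \<noteq> 0. c n)"
    and dif_linear: "Vector_Spaces.linear (scal L) (scal L) (dif L)"
    and dif_Deg: "x \<in> Deg L n \<Longrightarrow> dif L x \<in> Deg L (n + 1)"
    and dif_dif: "dif L (dif L x) = 0"
    and brk_linear_right: "Vector_Spaces.linear (scal L) (scal L) (brk L x)"
    and brk_linear_left: "Vector_Spaces.linear (scal L) (scal L) (\<lambda>x. brk L x y)"
    and brk_Deg: "x \<in> Deg L i \<Longrightarrow> y \<in> Deg L j \<Longrightarrow> brk L x y \<in> Deg L (i + j)"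
    and brk_antisym: "x \<in> Deg L i \<Longrightarrow> y \<in> Deg L j \<Longrightarrow>
      brk L x y = - scal L ((-1) powi (i * j)) (brk L y x)"
    and Jacobi: "x \<in> Deg L i \<Longrightarrow> y \<in> Deg L j \<Longrightarrow> z \<in> Deg L l \<Longrightarrow>
      brk L x (brk L y z)
        = brk L (brk L x y) z + scal L ((-1) powi (i * j)) (brk L y (brk L x z))"
    and Leibniz: "x \<in> Deg L i \<Longrightarrow> y \<in> Deg L j \<Longrightarrow>
      dif L (brk L x y) = brk L (dif L x) y + scal L ((-1) powi i) (brk L x (dif L y))"
    and Fil_graded_subspace: "r \<ge> 1 \<Longrightarrow> Fil L r = module.span (scal L) (\<Union>n. FD L r n)"
    and Fil_1: "Fil L 1 = UNIV"
    and Fil_decreasing: "r \<ge> 1 \<Longrightarrow> Fil L (Suc r) \<subseteq> Fil L r"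
    and Fil_complete:
      "bij_betw (\<lambda>x. \<lambda>r\<in>{1..}. x +o FD L r n) (Deg L n) (inverse_limit L n)"
    and dif_Fil: "r \<ge> 1 \<Longrightarrow> x \<in> Fil L r \<Longrightarrow> dif L x \<in> Fil L (Suc r)"
    and brk_Fil: "r \<ge> 1 \<Longrightarrow> s \<ge> 1 \<Longrightarrow> x \<in> Fil L r \<Longrightarrow> y \<in> Fil L s \<Longrightarrow>
      brk L x y \<in> Fil L (r + s)"

definition maurer_cartan :: "('k::field_char_0, 'g::ab_group_add) filtered_dgla \<Rightarrow> 'g set" where
  "maurer_cartan L = {m \<in> Deg L 1. dif L m + scal L (1/2) (brk L m m) = 0}"

text \<open>
  Infinite sums are limits of partial sums in the filtration topology. Limits are unique because
  the intersection of all \<open>Fil L r\<close> with \<open>r \<ge> 1\<close> is zero, so \<open>THE\<close> is harmless for convergent series.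
\<close>

definition fil_sums ::
    "('k, 'g::ab_group_add) filtered_dgla \<Rightarrow> (nat \<Rightarrow> 'g) \<Rightarrow> 'g \<Rightarrow> bool" where
  "fil_sums L a s \<longleftrightarrow> (\<forall>r\<ge>1. \<exists>N. \<forall>n\<ge>N. (\<Sum>i<n. a i) - s \<in> Fil L r)"

definition fil_suminf :: "('k, 'g::ab_group_add) filtered_dgla \<Rightarrow> (nat \<Rightarrow> 'g) \<Rightarrow> 'g" where
  "fil_suminf L a = (THE s. fil_sums L a s)"

definition gauge :: "('k::field_char_0, 'g::ab_group_add) filtered_dgla \<Rightarrow> 'g \<Rightarrow> 'g \<Rightarrow> 'g" where
  "gauge L p x =
     fil_suminf L (\<lambda>j. scal L (1 / fact j) ((brk L p ^^ j) x))
     - fil_suminf L (\<lambda>j. scal L (1 / fact (j + 1)) ((brk L p ^^ j) (dif L p)))"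

fun nested_brk :: "('k, 'g::ab_group_add) filtered_dgla \<Rightarrow> 'g list \<Rightarrow> 'g" where
  "nested_brk L [] = 0"
| "nested_brk L [x] = x"
| "nested_brk L (x # y # zs) = brk L x (nested_brk L (y # zs))"

text \<open>
  Dynkin's formula for \<open>log (e\<^sup>x e\<^sup>y)\<close>: with \<open>[x\<^sup>r\<^sup>1 y\<^sup>s\<^sup>1 \<dots>]\<close> the right-nested
  bracket of the word \<open>x \<dots> x y \<dots> y \<dots>\<close>, it is the sum over \<open>l \<ge> 1\<close> and over
  \<open>(r\<^sub>1, s\<^sub>1), \<dots>, (r\<^sub>l, s\<^sub>l)\<close> with all \<open>r\<^sub>i + s\<^sub>i > 0\<close> of
  \<open>(-1)\<^sup>l\<^sup>-\<^sup>1 / (l (\<Sum>i. r\<^sub>i + s\<^sub>i) (\<Prod>i. r\<^sub>i! s\<^sub>i!))\<close> times that bracket.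
  The terms are grouped by the word length \<open>n = (\<Sum>i. r\<^sub>i + s\<^sub>i)\<close>.
\<close>

definition dynkin_index :: "nat \<Rightarrow> (nat \<times> nat) list set" where
  "dynkin_index n = {rs. (\<forall>(r, s) \<in> set rs. r + s > 0) \<and> (\<Sum>(r, s)\<leftarrow>rs. r + s) = n}"

lemma finite_dynkin_index: "finite (dynkin_index n)"
proof -
  have "length rs \<le> n \<and> set rs \<subseteq> {..n} \<times> {..n}" if "rs \<in> dynkin_index n" for rs
    using that unfolding dynkin_index_def
    by (induction rs arbitrary: n) fastforce+
  then have "dynkin_index n \<subseteq> {rs. set rs \<subseteq> {..n} \<times> {..n} \<and> length rs \<le> n}" by blast
  then show ?thesis by (rule finite_subset) (simp add: finite_lists_length_le)
qed

definition dynkin_word :: "'g \<Rightarrow> 'g \<Rightarrow> (nat \<times> nat) list \<Rightarrow> 'g list" where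
  "dynkin_word x y rs = concat (map (\<lambda>(r, s). replicate r x @ replicate s y) rs)"

definition bch_part ::
    "('k::field_char_0, 'g::ab_group_add) filtered_dgla \<Rightarrow> 'g \<Rightarrow> 'g \<Rightarrow> nat \<Rightarrow> 'g" where
  "bch_part L x y n =
     (\<Sum>rs\<in>dynkin_index n.
        scal L ((-1) ^ (length rs + 1)
                 / (of_nat (length rs) * of_nat n * (\<Prod>(r, s)\<leftarrow>rs. fact r * fact s)))
          (nested_brk L (dynkin_word x y rs)))"

definition bch :: "('k::field_char_0, 'g::ab_group_add) filtered_dgla \<Rightarrow> 'g \<Rightarrow> 'g \<Rightarrow> 'g" where
  "bch L x y = fil_suminf L (\<lambda>n. bch_part L x y (Suc n))"

text \<open>
  The quotient \<open>Fil L r / Fil L (r + 1)\<close> consists of cosets, added as sets; \<open>gr L r n\<close> is its part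
  of degree \<open>n\<close>.
\<close>

definition gr_class :: "('k, 'g::ab_group_add) filtered_dgla \<Rightarrow> nat \<Rightarrow> 'g \<Rightarrow> 'g set" where
  "gr_class L r x = x +o Fil L (r + 1)"

definition gr :: "('k, 'g::ab_group_add) filtered_dgla \<Rightarrow> nat \<Rightarrow> int \<Rightarrow> 'g set set" where
  "gr L r n = gr_class L r ` FD L r n"

definition PP ::
    "('k::field_char_0, 'g::ab_group_add) filtered_dgla \<Rightarrow> nat \<Rightarrow> 'g \<Rightarrow> 'g \<Rightarrow> 'g set" where
  "PP L r m m' = {p \<in> FD L 1 0. gauge L p m - m' \<in> Fil L r}"

definition kappa ::
    "('k::field_char_0, 'g::ab_group_add) filtered_dgla \<Rightarrow> nat \<Rightarrow> 'g \<Rightarrow> 'g \<Rightarrow> 'g \<Rightarrow> 'g set" where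
  "kappa L k p m m' = gr_class L (k - 1) (gauge L p m - m')"

end

theory Submission
  imports Defs "HOL-Computational_Algebra.Formal_Power_Series" "HOL-Library.Product_Plus"
begin

text \<open>
  Write \<open>\<Gamma> p\<close> for the gauge action of \<open>p\<close> and \<open>F\<^sup>r\<close> for the filtration. Once
  \<open>\<Gamma> (q * p) = \<Gamma> q \<circ> \<Gamma> p\<close> is known, additivity is immediate: the error \<open>u = \<Gamma> p m0 - m1\<close> lies in
  \<open>F\<^sup>k\<^sup>-\<^sup>1\<close>, and \<open>\<Gamma> q\<close> is affine with linear part \<open>exp (ad q)\<close>, which is the identity up to terms
  that go one step deeper in the filtration. So \<open>\<Gamma> q (m1 + u) - m2\<close> and \<open>(\<Gamma> q m1 - m2) + u\<close> agree
  modulo \<open>F\<^sup>k\<close> (\<open>gauge_add\<close>).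

  The composition law (\<open>gauge_bch\<close>) is the substantial part. Adjoin an element \<open>d\<close> of degree 1
  with \<open>[p, d] = - \<delta>p\<close>. The series that defines \<open>\<Gamma> p\<close> then says \<open>\<Gamma> p x + d = exp (ad p) (x + d)\<close>,
  so the claim becomes the operator identity \<open>exp (ad (q * p)) = exp (ad q) exp (ad p)\<close>. On degree
  0 the map \<open>ad\<close> turns brackets into commutators (\<open>comm_ad_op\<close>), also after \<open>d\<close> has been adjoined;
  hence it suffices that Dynkin's series, formed with commutators of two elements \<open>x\<close> and \<open>y\<close> of
  an associative \<open>\<rat>\<close>-algebra, is \<open>log (exp x exp y)\<close> degree by degree (\<open>log_fexp_fexp_nth\<close>).

  To prove Dynkin's formula, introduce a formal variable \<open>t\<close> that records word length and put
  \<open>W = exp (t x) exp (t y)\<close> and \<open>U = W - 1\<close>. In a right-nested bracket the prefix \<open>x\<^sup>r y\<^sup>s\<close> acts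
  as \<open>ad\<^sub>x\<^sup>r ad\<^sub>y\<^sup>s\<close>, and \<open>\<Sum> ad\<^sub>x\<^sup>r ad\<^sub>y\<^sup>s t\<^sup>r\<^sup>+\<^sup>s / (r! s!)\<close> is conjugation by \<open>W\<close>. So the terms
  of Dynkin's formula that come from \<open>l + 1\<close> pairs \<open>(r, s)\<close> have the derivative
  \<open>(Conj\<^sub>W - 1)\<^sup>l (W' W\<^sup>-\<^sup>1)\<close>, apart from the factor \<open>(-1)\<^sup>l / (l + 1)\<close>; here
  \<open>W' W\<^sup>-\<^sup>1 = x + exp (t x) y exp (- t x)\<close> collects the case of one pair. Since
  \<open>(Conj\<^sub>W - 1) F = [U, F] W\<^sup>-\<^sup>1\<close> and \<open>W\<close> commutes with \<open>U\<close>, this is \<open>[U, \<sqdot>]\<^sup>l (U') W\<^sup>-\<^sup>l\<^sup>-\<^sup>1\<close>,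
  and the sum over \<open>l\<close> is the noncommutative form of \<open>(log (1 + U))'\<close> (\<open>deriv_log_nth\<close>). Comparing
  derivatives gives the formula.

  Formal identities are carried over to the complete filtered setting by truncation: modulo
  operators that raise the filtration by \<open>N\<close>, all series are polynomials (\<open>texp_dynkin\<close>), and the
  intersection of all \<open>F\<^sup>r\<close> is zero (\<open>Inter_Fil\<close>).
\<close>

unbundle fps_syntax

section \<open>Substituting into rational power series over a noncommutative ring\<close>

text \<open>
  A \<open>\<rat>\<close>-algebra structure on a noncommutative ring, given by its unit map \<open>emb\<close>; the scalars are
  central by \<open>emb_central\<close>.
\<close>

locale rat_algebra =
  fixes emb :: "rat \<Rightarrow> 'a::ring_1"
  assumes emb_1 [simp]: "emb 1 = 1"
    and emb_add: "emb (a + b) = emb a + emb b"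
    and emb_mult: "emb (a * b) = emb a * emb b"
begin

lemma emb_0 [simp]: "emb 0 = 0"
  using emb_add[of 0 0] by simp

lemma emb_minus: "emb (- a) = - emb a"
  using emb_add[of a "- a"] by (simp add: eq_neg_iff_add_eq_0 add.commute)

lemma emb_of_nat: "emb (of_nat n) = of_nat n"
  by (induction n) (simp_all add: emb_add)

lemma emb_sum: "emb (sum f S) = (\<Sum>i\<in>S. emb (f i))"
  by (induction S rule: infinite_finite_induct) (simp_all add: emb_add)

text \<open>
  Integers are central in every ring, and the inverse of a central unit is central.
\<close>

lemma emb_central: "emb c * a = a * emb c"
proof -
  obtain i n where c: "c = of_int i / of_nat n" and n: "n > 0"
  proof -
    obtain i j where "quotient_of c = (i, j)" by force
    then have "c = of_int i / of_int j" "j > 0"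
      by (simp_all add: quotient_of_div quotient_of_denom_pos)
    then show ?thesis using that[of i "nat j"] by simp
  qed
  have i: "emb (of_int i) = of_int i"
    by (cases i rule: int_cases2) (simp_all add: emb_of_nat emb_minus)
  have *: "of_nat n * emb c = of_int i" "emb c * of_nat n = of_int i"
    using n by (simp_all add: c i flip: emb_of_nat emb_mult)
  have "emb c * a = emb (1 / of_nat n) * (of_nat n * emb c) * a"
    using n by (simp flip: emb_of_nat emb_mult mult.assoc)
  also have "\<dots> = emb (1 / of_nat n) * a * of_int i"
    by (simp add: * mult.assoc mult_of_int_commute)
  also have "\<dots> = emb (1 / of_nat n) * a * (of_nat n * emb c)"
    by (simp only: *)
  also have "\<dots> = (emb (1 / of_nat n) * of_nat n) * a * emb c"
    by (metis mult.assoc mult_of_nat_commute)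
  also have "\<dots> = a * emb c"
    using n by (simp flip: emb_of_nat emb_mult)
  finally show ?thesis .
qed

lemma emb_left_commute: "a * (emb c * b) = emb c * (a * b)"
  by (simp add: emb_central[of c] mult.assoc)

lemma of_nat_mult_cancel:
  assumes "n > 0" "of_nat n * a = of_nat n * (b :: 'a)"
  shows "a = b"
proof -
  have "emb (1 / of_nat n) * of_nat n = 1"
    using assms(1) by (simp flip: emb_of_nat emb_mult)
  then show ?thesis
    using arg_cong[OF assms(2), of "\<lambda>z. emb (1 / of_nat n) * z"] by (simp flip: mult.assoc)
qed

lemma fps_eqI_deriv:
  assumes "fps_deriv F = fps_deriv G" "F $ 0 = (G $ 0 :: 'a)"
  shows "F = G"
proof (rule fps_ext)
  fix n show "F $ n = G $ n"
  proof (cases n)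
    case (Suc m)
    then have "of_nat n * F $ n = of_nat n * G $ n"
      using arg_cong[OF assms(1), of "\<lambda>F. F $ m"] by simp
    then show ?thesis using Suc of_nat_mult_cancel[of n "F $ n" "G $ n"] by blast
  qed (use assms in simp)
qed

text \<open>
  The value of a rational power series at \<open>U \<in> A[[t]]\<close>. Both arguments of \<open>oo\<close> must have the same
  coefficient ring, hence the coefficients of \<open>f\<close> are embedded first. The value is the intended
  one when \<open>U\<close> has no constant term.
\<close>

definition subst :: "rat fps \<Rightarrow> 'a fps \<Rightarrow> 'a fps" where
  "subst f U = Abs_fps (\<lambda>n. emb (f $ n)) oo U"

lemma subst_nth: "subst f U $ n = (\<Sum>i\<le>n. emb (f $ i) * U ^ i $ n)"
  by (simp add: subst_def fps_compose_nth atMost_atLeast0)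

lemma subst_nth_upto:
  assumes "U $ 0 = 0" "n \<le> N"
  shows "subst f U $ n = (\<Sum>i\<le>N. emb (f $ i) * U ^ i $ n)"
  unfolding subst_nth using assms startsby_zero_power_prefix[of U]
  by (intro sum.mono_neutral_left) auto

lemma subst_nth_0: "subst f U $ 0 = emb (f $ 0)"
  by (simp add: subst_nth)

lemma mult_subst_nth:
  assumes "U $ 0 = 0"
  shows "(F * subst f U) $ n = (\<Sum>i\<le>n. emb (f $ i) * (F * U ^ i) $ n)"
proof -
  have "(F * subst f U) $ n = (\<Sum>k=0..n. F $ k * (\<Sum>i\<le>n. emb (f $ i) * U ^ i $ (n - k)))"
    unfolding fps_mult_nth by (intro sum.cong refl) (simp add: subst_nth_upto[OF assms, of _ n])
  also have "\<dots> = (\<Sum>i\<le>n. \<Sum>k=0..n. emb (f $ i) * (F $ k * U ^ i $ (n - k)))"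
    by (subst sum.swap) (simp add: sum_distrib_left emb_left_commute)
  finally show ?thesis by (simp add: fps_mult_nth sum_distrib_left)
qed

text \<open>
  Only powers of the single element \<open>U\<close> and central scalars occur, so substitution is a ring
  homomorphism although \<open>A\<close> is noncommutative. This is what allows identities between commutative
  power series, such as \<open>exp (log (1 + X)) = 1 + X\<close>, to be used in \<open>A[[t]]\<close>.
\<close>

lemma subst_mult:
  assumes U: "U $ 0 = 0"
  shows "subst (f * g) U = subst f U * subst g U"
proof (rule fps_ext)
  fix n
  have comm: "(subst f U * U ^ j) $ n = (\<Sum>i\<le>n. emb (f $ i) * (U ^ (i + j)) $ n)" for j
  proof -
    have "(subst f U * U ^ j) $ n
        = (\<Sum>k=0..n. (\<Sum>i\<le>n. emb (f $ i) * U ^ i $ k) * U ^ j $ (n - k))"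
      unfolding fps_mult_nth by (intro sum.cong refl) (simp add: subst_nth_upto[OF U, of _ n])
    also have "\<dots> = (\<Sum>i\<le>n. \<Sum>k=0..n. emb (f $ i) * (U ^ i $ k * U ^ j $ (n - k)))"
      by (subst sum.swap) (simp add: sum_distrib_right mult.assoc)
    finally show ?thesis by (simp add: fps_mult_nth sum_distrib_left power_add)
  qed
  let ?t = "\<lambda>i j. emb (f $ i * g $ j) * (U ^ (i + j)) $ n"
  have "(subst f U * subst g U) $ n = (\<Sum>j\<le>n. \<Sum>i\<le>n. ?t i j)"
    unfolding mult_subst_nth[OF U] comm
    by (simp add: sum_distrib_left mult.commute[of "f $ _"] emb_mult mult.assoc)
  also have "\<dots> = (\<Sum>(i, j)\<in>{..n} \<times> {..n}. ?t i j)"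
    by (subst sum.swap) (simp add: sum.cartesian_product)
  also have "\<dots> = (\<Sum>(i, j)\<in>{(i, j). i + j \<le> n}. ?t i j)"
    using startsby_zero_power_prefix[OF U] by (intro sum.mono_neutral_right) (auto simp flip: not_less)
  also have "\<dots> = (\<Sum>m\<le>n. \<Sum>i\<le>m. ?t i (m - i))"
    by (rule sum.triangle_reindex_eq)
  also have "\<dots> = subst (f * g) U $ n"
    unfolding subst_nth
    by (intro sum.cong refl) (simp add: fps_mult_nth emb_sum sum_distrib_right atMost_atLeast0)
  finally show "subst (f * g) U $ n = (subst f U * subst g U) $ n" ..
qed

lemma subst_1: "subst 1 U = 1"
proof (rule fps_ext)
  fix n
  have "subst 1 U $ n = (\<Sum>i\<le>n. if i = 0 then U ^ i $ n else 0)"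
    unfolding subst_nth by (intro sum.cong) auto
  then show "subst 1 U $ n = 1 $ n" by simp
qed

lemma subst_X:
  assumes "U $ 0 = 0"
  shows "subst fps_X U = U"
proof (rule fps_ext)
  fix n
  have "subst fps_X U $ n = (\<Sum>i\<le>n. if i = 1 then U ^ i $ n else 0)"
    unfolding subst_nth by (intro sum.cong) auto
  then show "subst fps_X U $ n = U $ n" using assms by (cases n) simp_all
qed

lemma subst_add: "subst (f + g) U = subst f U + subst g U"
  by (rule fps_ext) (simp add: subst_nth emb_add distrib_right sum.distrib)

lemma subst_power: "U $ 0 = 0 \<Longrightarrow> subst (f ^ n) U = subst f U ^ n"
  by (induction n) (simp_all add: subst_1 subst_mult)

lemma subst_compose:
  assumes "U $ 0 = 0" "g $ 0 = 0"
  shows "subst (f oo g) U = subst f (subst g U)"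
proof (rule fps_ext)
  fix n
  have "subst f (subst g U) $ n = (\<Sum>i\<le>n. emb (f $ i) * (\<Sum>j\<le>n. emb (g ^ i $ j) * U ^ j $ n))"
    by (simp add: subst_nth flip: subst_power[OF assms(1)])
  also have "\<dots> = (\<Sum>j\<le>n. (\<Sum>i\<le>n. emb (f $ i * g ^ i $ j)) * U ^ j $ n)"
    by (simp add: sum_distrib_left sum_distrib_right emb_mult mult.assoc) (rule sum.swap)
  also have "\<dots> = (\<Sum>j\<le>n. emb ((f oo g) $ j) * U ^ j $ n)"
  proof (intro sum.cong refl, goal_cases)
    case (1 j)
    have "(f oo g) $ j = (\<Sum>i\<le>n. f $ i * g ^ i $ j)"
      unfolding fps_compose_nth using 1 startsby_zero_power_prefix[OF assms(2)]
      by (intro sum.mono_neutral_left) auto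
    then show ?case by (simp add: emb_sum)
  qed
  finally show "subst (f oo g) U $ n = subst f (subst g U) $ n"
    by (simp add: subst_nth)
qed

end

section \<open>The derivative of the logarithm\<close>

definition comm :: "'a::ring \<Rightarrow> 'a \<Rightarrow> 'a" where
  "comm a b = a * b - b * a"

lemma comm_pow_add: "(comm a ^^ n) (b + c) = (comm a ^^ n) b + (comm a ^^ n) c"
  by (induction n) (simp_all add: comm_def algebra_simps)

lemma comm_pow_0 [simp]: "(comm a ^^ n) 0 = 0"
  by (induction n) (simp_all add: comm_def)

lemma comm_pow_sum: "(comm a ^^ n) (sum f S) = (\<Sum>i\<in>S. (comm a ^^ n) (f i))"
  by (induction S rule: infinite_finite_induct) (simp_all add: comm_pow_add)

lemma fps_mult_nth_eq_0:
  assumes "\<And>i. i < a \<Longrightarrow> F $ i = 0" "\<And>i. i < b \<Longrightarrow> G $ i = 0" "n < a + b"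
  shows "(F * G) $ n = (0 :: 'a::ring_1)"
  unfolding fps_mult_nth
proof (intro sum.neutral ballI)
  fix i assume "i \<in> {0..n}"
  then have "i < a \<or> n - i < b" using assms(3) by auto
  then show "F $ i * G $ (n - i) = 0" using assms(1,2) by auto
qed

lemma comm_pow_nth_eq_0:
  assumes "U $ 0 = (0 :: 'a::ring_1)" "i < l"
  shows "(comm U ^^ l) F $ i = 0"
  using assms(2)
proof (induction l arbitrary: i)
  case (Suc l)
  have U: "U $ i = 0" if "i < 1" for i using that assms(1) by simp
  have "(U * (comm U ^^ l) F) $ i = 0" "((comm U ^^ l) F * U) $ i = 0"
    using fps_mult_nth_eq_0[of 1 U l "(comm U ^^ l) F" i] fps_mult_nth_eq_0[of l "(comm U ^^ l) F" 1 U i]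
      U Suc by auto
  then show ?case by (simp add: comm_def[of U "(comm U ^^ l) F"])
qed simp

text \<open>
  The Leibniz rule gives \<open>\<Sum> U\<^sup>i U' U\<^sup>j\<close> over \<open>i + j = N\<close>. Left multiplication by \<open>U\<close> is the sum of
  the commuting operators \<open>[U, \<sqdot>]\<close> and right multiplication by \<open>U\<close>; moving all factors \<open>U\<close> to the
  right therefore yields binomial coefficients.
\<close>

lemma deriv_power_commutator:
  fixes U :: "'a::ring_1 fps"
  shows "fps_deriv (U ^ Suc N)
    = (\<Sum>l\<le>N. of_nat (Suc N choose Suc l) * ((comm U ^^ l) (fps_deriv U) * U ^ (N - l)))"
proof (induction N)
  case (Suc N)
  let ?D = "\<lambda>l. (comm U ^^ l) (fps_deriv U)"
  have *: "U * ?D l = ?D (Suc l) + ?D l * U" for l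
    by (simp add: comm_def)
  have "U * (of_nat c * (?D l * U ^ (N - l)))
      = of_nat c * (?D (Suc l) * U ^ (N - l)) + of_nat c * (?D l * U ^ (Suc N - l))" if "l \<le> N" for l c
  proof -
    have "U * (of_nat c * (?D l * U ^ (N - l))) = of_nat c * (U * ?D l) * U ^ (N - l)"
      using mult_of_nat_commute[of c U] by (metis mult.assoc)
    then show ?thesis
      unfolding * using that by (simp add: algebra_simps Suc_diff_le)
  qed
  then have "U * fps_deriv (U ^ Suc N)
      = (\<Sum>l\<le>N. of_nat (Suc N choose Suc l) * (?D (Suc l) * U ^ (N - l)))
      + (\<Sum>l\<le>N. of_nat (Suc N choose Suc l) * (?D l * U ^ (Suc N - l)))"
    unfolding Suc.IH by (simp add: sum_distrib_left del: binomial_Suc_Suc of_nat_add flip: sum.distrib)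
  moreover have "(\<Sum>l\<le>Suc N. of_nat (Suc N choose l) * (?D l * U ^ (Suc N - l)))
      = ?D 0 * U ^ Suc N + (\<Sum>l\<le>N. of_nat (Suc N choose Suc l) * (?D (Suc l) * U ^ (N - l)))"
    by (subst sum.atMost_Suc_shift) (simp del: binomial_Suc_Suc)
  moreover have "(\<Sum>l\<le>Suc N. of_nat (Suc N choose Suc l) * (?D l * U ^ (Suc N - l)))
      = (\<Sum>l\<le>N. of_nat (Suc N choose Suc l) * (?D l * U ^ (Suc N - l)))"
    by (simp add: binomial_eq_0 del: binomial_Suc_Suc)
  moreover have "fps_deriv (U ^ Suc (Suc N)) = U * fps_deriv (U ^ Suc N) + ?D 0 * U ^ Suc N"
    by (subst power_Suc) (simp only: fps_deriv_mult funpow_0)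
  moreover have "of_nat (Suc (Suc N) choose Suc l) * z
      = of_nat (Suc N choose l) * z + of_nat (Suc N choose Suc l) * z" for l and z :: "'a fps"
    by (simp only: binomial_Suc_Suc of_nat_add distrib_right)
  ultimately show ?case
    by (simp only: sum.distrib ac_simps)
qed simp

text \<open>
  One step is \<open>W G V - G = (W G - G W) V = [U, G] V\<close> for \<open>W = 1 + U\<close> and \<open>V = W\<^sup>-\<^sup>1\<close>; the factors
  \<open>V\<close> stay on the right.
\<close>

lemma conj_minus_id_pow:
  fixes U V :: "'a::ring_1"
  assumes "V * (1 + U) = 1" "(1 + U) * V = 1"
  shows "((\<lambda>F. (1 + U) * F * V - F) ^^ l) (F * V) = (comm U ^^ l) F * V ^ Suc l"
proof (induction l)
  case (Suc l)
  let ?G = "(comm U ^^ l) F"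
  have "?G * V ^ Suc l = ?G * ((1 + U) * V) * V ^ Suc l"
    by (simp only: assms(2) mult.right_neutral)
  also have "\<dots> = ?G * (1 + U) * V ^ Suc (Suc l)"
    by (simp only: power_Suc[of V "Suc l"] mult.assoc)
  finally have "?G * V ^ Suc l = ?G * (1 + U) * V ^ Suc (Suc l)" .
  moreover have "(1 + U) * (?G * V ^ Suc l) * V = (1 + U) * ?G * V ^ Suc (Suc l)"
    by (simp only: power_Suc2[of V "Suc l"] mult.assoc)
  ultimately have "(1 + U) * (?G * V ^ Suc l) * V - ?G * V ^ Suc l
      = (1 + U) * ?G * V ^ Suc (Suc l) - ?G * (1 + U) * V ^ Suc (Suc l)"
    by argo
  also have "\<dots> = comm U ?G * V ^ Suc (Suc l)"
    unfolding left_diff_distrib[symmetric] by (simp add: comm_def distrib_left distrib_right)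
  finally show ?case by (simp only: funpow.simps comp_apply Suc.IH)
qed simp

context rat_algebra
begin

lemma of_nat_mult_emb: "of_nat n * (emb c * a) = emb (of_nat n * c) * a"
  by (simp add: emb_mult emb_of_nat mult.assoc)

lemma comm_pow_emb: "(comm a ^^ n) (emb c * b) = emb c * (comm a ^^ n) b"
  by (induction n) (simp_all add: comm_def right_diff_distrib mult.assoc emb_left_commute)

text \<open>
  The series \<open>exp (t z)\<close>, where \<open>t\<close> is the variable of the power series.
\<close>

definition fexp :: "'a \<Rightarrow> 'a fps" where
  "fexp z = Abs_fps (\<lambda>n. emb (1 / fact n) * z ^ n)"

lemma fexp_nth: "fexp z $ n = emb (1 / fact n) * z ^ n"
  by (simp add: fexp_def)

lemma fexp_commute: "fexp z * fps_const z = fps_const z * fexp z"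
  by (rule fps_ext) (simp add: fexp_nth emb_left_commute mult.assoc power_commutes)

lemma fps_deriv_fexp: "fps_deriv (fexp z) = fps_const z * fexp z"
proof (rule fps_ext)
  fix n
  have "fps_deriv (fexp z) $ n = emb (of_nat (Suc n) * (1 / fact (Suc n))) * z ^ Suc n"
    by (simp only: fps_deriv_nth fexp_nth of_nat_mult_emb Suc_eq_plus1)
  also have "of_nat (Suc n) * (1 / fact (Suc n)) = (1 / fact n :: rat)"
    by (simp add: divide_simps)
  finally show "fps_deriv (fexp z) $ n = (fps_const z * fexp z) $ n"
    by (simp add: fexp_nth emb_left_commute)
qed

lemma fexp_inverse: "fexp z * fexp (- z) = 1"
proof (rule fps_eqI_deriv)
  have "fps_deriv (fexp z * fexp (- z)) = - (fexp z * fps_const z) * fexp (- z) + fps_const z * fexp z * fexp (- z)"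
    by (simp add: fps_deriv_fexp mult.assoc flip: fps_const_neg)
  then show "fps_deriv (fexp z * fexp (- z)) = fps_deriv 1"
    by (simp add: fexp_commute)
qed (simp add: fexp_nth)

lemma fexp_inverse': "fexp (- z) * fexp z = 1"
  using fexp_inverse[of "- z"] by simp

definition Ad :: "'a \<Rightarrow> 'a fps \<Rightarrow> 'a fps" where
  "Ad z F = fexp z * F * fexp (- z)"

text \<open>
  This is \<open>exp (t z) a exp (- t z) = exp (t ad z) a\<close>. The left-hand side satisfies the
  differential equation \<open>(Ad z a)' = Ad z [z, a]\<close>, which determines its coefficients recursively.
\<close>

lemma Ad_const_nth: "Ad z (fps_const a) $ n = emb (1 / fact n) * (comm z ^^ n) a"
proof (induction n arbitrary: a)
  case (Suc n)
  have "fps_deriv (Ad z (fps_const a)) = Ad z (fps_const (comm z a))"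
  proof -
    have "fps_deriv (Ad z (fps_const a))
        = (fps_const z * fexp z) * fps_const a * fexp (- z) - fexp z * fps_const a * (fps_const z * fexp (- z))"
      by (simp add: Ad_def fps_deriv_fexp mult.assoc flip: fps_const_neg)
    also have "\<dots> = fexp z * (fps_const z * fps_const a - fps_const a * fps_const z) * fexp (- z)"
      unfolding fexp_commute[symmetric] by (simp only: algebra_simps)
    finally show ?thesis by (simp add: Ad_def comm_def)
  qed
  then have "of_nat (Suc n) * Ad z (fps_const a) $ Suc n = emb (1 / fact n) * (comm z ^^ Suc n) a"
    using Suc.IH[of "comm z a"] fps_deriv_nth[of "Ad z (fps_const a)" n]
    by (simp add: funpow_swap1)
  also have "\<dots> = of_nat (Suc n) * (emb (1 / fact (Suc n)) * (comm z ^^ Suc n) a)"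
    by (subst of_nat_mult_emb) (simp add: divide_simps)
  finally show ?case by (rule of_nat_mult_cancel[rotated]) simp
qed (simp add: Ad_def fexp_nth)

lemma Ad_nth: "Ad z F $ n = (\<Sum>r\<le>n. emb (1 / fact r) * (comm z ^^ r) (F $ (n - r)))"
proof (induction n arbitrary: F)
  case (Suc n)
  have "F = fps_const (F $ 0) + fps_X * fps_shift 1 F"
    by (rule fps_ext) simp
  then have "Ad z F = Ad z (fps_const (F $ 0) + fps_X * fps_shift 1 F)"
    by (rule arg_cong)
  also have "\<dots> = Ad z (fps_const (F $ 0)) + (fexp z * fps_X) * fps_shift 1 F * fexp (- z)"
    by (simp only: Ad_def distrib_left distrib_right mult.assoc)
  also have "(fexp z * fps_X) * fps_shift 1 F * fexp (- z) = fps_X * Ad z (fps_shift 1 F)"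
    unfolding fps_mult_fps_X_commute[symmetric] by (simp only: Ad_def mult.assoc)
  finally show ?case
    using Suc[of "fps_shift 1 F"] by (simp add: Ad_const_nth Suc_diff_le)
qed (simp add: Ad_def fexp_nth)

text \<open>
  The coefficients are those of \<open>(1 + X)\<^sup>-\<^sup>l\<^sup>-\<^sup>1\<close>; by Pascal's rule, multiplication by \<open>1 + X\<close>
  turns the series for \<open>l + 1\<close> into the one for \<open>l\<close>.
\<close>

lemma inverse_power_eq_subst:
  assumes "U $ 0 = 0" "V * (1 + U) = 1"
  shows "V ^ Suc l = subst (Abs_fps (\<lambda>j. (-1) ^ j * of_nat (l + j choose l))) U"
proof -
  let ?g = "\<lambda>l. Abs_fps (\<lambda>j. (-1) ^ j * of_nat (l + j choose l)) :: rat fps"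
  have V: "F = V * subst h U" if "(1 + fps_X) * g = h" "F = subst g U" for F g h
  proof -
    have "subst h U = (1 + U) * F"
      using assms(1) by (simp add: subst_mult subst_add subst_1 subst_X flip: that)
    then show ?thesis using assms(2) by (simp flip: mult.assoc)
  qed
  show ?thesis
  proof (induction l)
    case 0
    have "(1 + fps_X) * ?g 0 = 1"
    proof (rule fps_ext)
      fix n show "((1 + fps_X) * ?g 0) $ n = 1 $ n"
        by (cases n) (simp_all add: distrib_right)
    qed
    from V[OF this refl] show ?case by (simp add: subst_1)
  next
    case (Suc l)
    have "(1 + fps_X) * ?g (Suc l) = ?g l"
    proof (rule fps_ext)
      fix n show "((1 + fps_X) * ?g (Suc l)) $ n = ?g l $ n"
        by (cases n) (simp_all add: distrib_right algebra_simps)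
    qed
    from V[OF this refl] Suc show ?case by simp
  qed
qed

text \<open>
  Expand \<open>(U\<^sup>N\<^sup>+\<^sup>1)'\<close> into commutators and collect the terms with the same \<open>[U, \<sqdot>]\<^sup>l (U')\<close>.
  Because \<open>1 / (N + 1) * (N + 1 choose l + 1) = 1 / (l + 1) * (N choose l)\<close>, the powers of \<open>U\<close> to
  its right add up to the binomial series of \<open>(1 + U)\<^sup>-\<^sup>l\<^sup>-\<^sup>1 = V\<^sup>l\<^sup>+\<^sup>1\<close>.
\<close>

lemma deriv_log_nth:
  assumes U: "U $ 0 = 0" and V: "V * (1 + U) = 1"
  shows "fps_deriv (subst (fps_ln 1) U) $ n
    = (\<Sum>l\<le>n. emb ((-1) ^ l / of_nat (Suc l)) * ((comm U ^^ l) (fps_deriv U) * V ^ Suc l) $ n)"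
proof -
  define T where "T l j = ((comm U ^^ l) (fps_deriv U) * U ^ j) $ n" for l j
  define t where "t l j = emb ((-1) ^ (l + j) / of_nat (Suc (l + j)) * of_nat (Suc (l + j) choose Suc l)) * T l j" for l j
  have T0: "T l j = 0" if "n < l + j" for l j
    unfolding T_def using that comm_pow_nth_eq_0[OF U] startsby_zero_power_prefix[OF U]
    by (intro fps_mult_nth_eq_0[of l _ j]) auto
  have "fps_deriv (subst (fps_ln 1) U) $ n
      = of_nat (Suc n) * (\<Sum>i\<le>Suc n. emb (fps_ln 1 $ i) * U ^ i $ Suc n)"
    by (simp only: fps_deriv_nth subst_nth Suc_eq_plus1)
  also have "\<dots> = of_nat (Suc n) * (\<Sum>N\<le>n. emb (fps_ln 1 $ Suc N) * U ^ Suc N $ Suc n)"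
    by (subst sum.atMost_Suc_shift) simp
  also have "\<dots> = (\<Sum>N\<le>n. emb (fps_ln 1 $ Suc N) * (fps_deriv (U ^ Suc N)) $ n)"
    by (simp only: sum_distrib_left fps_deriv_nth Suc_eq_plus1 emb_left_commute)
  also have "\<dots> = (\<Sum>N\<le>n. \<Sum>l\<le>N. t l (N - l))"
  proof (intro sum.cong refl)
    fix N
    have *: "(of_nat c * F) $ n = emb (of_nat c) * F $ n" for c and F :: "'a fps"
      unfolding emb_of_nat fps_of_nat[symmetric] by (rule fps_mult_left_const_nth)
    then show "emb (fps_ln 1 $ Suc N) * (fps_deriv (U ^ Suc N)) $ n = (\<Sum>l\<le>N. t l (N - l))"
      unfolding deriv_power_commutator fps_sum_nth sum_distrib_left t_def T_def *
      by (intro sum.cong refl)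
        (simp add: fps_ln_nth power_add del: binomial_Suc_Suc of_nat_Suc flip: mult.assoc emb_mult)
  qed
  also have "\<dots> = (\<Sum>(l, j)\<in>{(l, j). l + j \<le> n}. t l j)"
    by (rule sum.triangle_reindex_eq[symmetric])
  also have "\<dots> = (\<Sum>(l, j)\<in>{..n} \<times> {..n}. t l j)"
    using T0 by (intro sum.mono_neutral_left) (auto simp: t_def simp flip: not_less)
  also have "\<dots> = (\<Sum>l\<le>n. \<Sum>j\<le>n. t l j)"
    by (simp add: sum.cartesian_product)
  also have "\<dots> = (\<Sum>l\<le>n. emb ((-1) ^ l / of_nat (Suc l)) * ((comm U ^^ l) (fps_deriv U) * V ^ Suc l) $ n)"
  proof (intro sum.cong refl)
    fix l
    have "t l j = emb ((-1) ^ l / of_nat (Suc l)) * (emb ((-1) ^ j * of_nat (l + j choose l)) * T l j)" for j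
    proof -
      have "of_nat (Suc l) * of_nat (Suc (l + j) choose Suc l) = (of_nat (Suc (l + j)) * of_nat (l + j choose l) :: rat)"
        unfolding of_nat_mult[symmetric] Suc_times_binomial ..
      then have "(-1) ^ (l + j) / of_nat (Suc (l + j)) * of_nat (Suc (l + j) choose Suc l)
        = ((-1) ^ l / of_nat (Suc l)) * ((-1) ^ j * of_nat (l + j choose l) :: rat)"
        by (simp add: divide_simps power_add del: binomial_Suc_Suc of_nat_Suc) (simp add: ac_simps)
      then show ?thesis unfolding t_def by (simp only: emb_mult mult.assoc)
    qed
    then show "(\<Sum>j\<le>n. t l j) = emb ((-1) ^ l / of_nat (Suc l)) * ((comm U ^^ l) (fps_deriv U) * V ^ Suc l) $ n"
      unfolding inverse_power_eq_subst[OF U V] mult_subst_nth[OF U]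
      by (simp add: T_def sum_distrib_left)
  qed
  finally show ?thesis .
qed

lemma exp_log:
  assumes "U $ 0 = 0"
  shows "subst (fps_exp 1) (subst (fps_ln 1) U) = 1 + U"
proof -
  have "fps_exp 1 oo fps_ln 1 = (1 + fps_X :: rat fps)"
  proof -
    have "(fps_exp 1 - 1) oo fps_ln 1 = (fps_X :: rat fps)"
      unfolding fps_ln_fps_exp_inv[OF one_neq_zero] by (rule fps_inv_right) simp_all
    then show ?thesis by (simp add: fps_compose_sub_distrib algebra_simps)
  qed
  then show ?thesis
    using assms by (simp add: subst_add subst_1 subst_X flip: subst_compose)
qed

end

section \<open>Dynkin's formula\<close>

text \<open>
  The counterpart of \<open>nested_brk\<close> in an associative ring.
\<close>

fun nested_comm :: "'a::ring list \<Rightarrow> 'a" where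
  "nested_comm [] = 0"
| "nested_comm [x] = x"
| "nested_comm (x # y # zs) = comm x (nested_comm (y # zs))"

lemma nested_comm_Cons: "w \<noteq> [] \<Longrightarrow> nested_comm (x # w) = comm x (nested_comm w)"
  by (cases w) simp_all

lemma nested_comm_replicate_append:
  "w \<noteq> [] \<Longrightarrow> nested_comm (replicate n x @ w) = (comm x ^^ n) (nested_comm w)"
  by (induction n) (simp_all add: nested_comm_Cons)

lemma nested_comm_replicate: "nested_comm (replicate (Suc (Suc n)) x) = 0"
  using nested_comm_replicate_append[of "[x, x]" n x]
  by (simp add: comm_def replicate_app_Cons_same)

lemma length_dynkin_word: "rs \<in> dynkin_index n \<Longrightarrow> length (dynkin_word x y rs) = n"
  by (auto simp: dynkin_index_def dynkin_word_def length_concat comp_def case_prod_unfold)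

lemma set_dynkin_word: "set (dynkin_word x y rs) \<subseteq> {x, y}"
  unfolding dynkin_word_def set_concat set_map by (force split: if_splits)

lemma dynkin_word_eq_Nil:
  "rs \<in> dynkin_index n \<Longrightarrow> n > 0 \<Longrightarrow> dynkin_word x y rs \<noteq> []"
  by (cases rs) (auto simp: dynkin_index_def dynkin_word_def)

text \<open>
  At least one further pair follows the first pair \<open>(r, s)\<close> and contributes at least 1 to the
  total, whence \<open>r + s \<le> n\<close> and not merely \<open>r + s \<le> n + 1\<close>.
\<close>

lemma dynkin_index_length_Suc_Suc:
  "{rs \<in> dynkin_index (Suc n). length rs = Suc (Suc l)}
   = (\<lambda>((r, s), rs). (r, s) # rs) ` (SIGMA (r, s):{(r, s). 0 < r + s \<and> r + s \<le> n}.
        {rs \<in> dynkin_index (Suc (n - (r + s))). length rs = Suc l})" (is "?A = ?f ` ?B")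
proof (intro subset_antisym subsetI)
  fix rs assume "rs \<in> ?A"
  then obtain r s r' s' rs' where rs: "rs = (r, s) # (r', s') # rs'"
    by (auto simp: length_Suc_conv)
  with \<open>rs \<in> ?A\<close> have "((r, s), (r', s') # rs') \<in> ?B"
    by (auto simp: dynkin_index_def)
  then show "rs \<in> ?f ` ?B" by (rule rev_image_eqI) (simp add: rs)
next
  fix rs assume "rs \<in> ?f ` ?B"
  then show "rs \<in> ?A" by (auto simp: dynkin_index_def)
qed

context rat_algebra
begin

definition word_coeff :: "(nat \<times> nat) list \<Rightarrow> rat" where
  "word_coeff rs = 1 / (\<Prod>(r, s)\<leftarrow>rs. fact r * fact s)"

text \<open>
  The terms of Dynkin's formula for words of length \<open>n\<close> that come from lists of \<open>l\<close> pairs, without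
  the factor \<open>(-1)\<^sup>l\<^sup>+\<^sup>1 / (l n)\<close>, which is constant on them.
\<close>

definition dynkin_length_part :: "'a \<Rightarrow> 'a \<Rightarrow> nat \<Rightarrow> nat \<Rightarrow> 'a" where
  "dynkin_length_part x y l n =
     (\<Sum>rs | rs \<in> dynkin_index n \<and> length rs = l. emb (word_coeff rs) * nested_comm (dynkin_word x y rs))"

lemma dynkin_length_part_Suc_Suc:
  "dynkin_length_part x y (Suc (Suc l)) (Suc n) =
     (\<Sum>(r, s) | 0 < r + s \<and> r + s \<le> n. emb (1 / fact r) * (comm x ^^ r)
        (emb (1 / fact s) * (comm y ^^ s) (dynkin_length_part x y (Suc l) (Suc (n - (r + s))))))"
proof -
  let ?P = "{(r, s). 0 < r + s \<and> r + s \<le> n}"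
  let ?Q = "\<lambda>r s. {rs \<in> dynkin_index (Suc (n - (r + s))). length rs = Suc l}"
  let ?c = "\<lambda>rs. emb (word_coeff rs) * nested_comm (dynkin_word x y rs)"
  have fin: "finite ?P" by (rule finite_subset[of _ "{..n} \<times> {..n}"]) auto
  have "dynkin_length_part x y (Suc (Suc l)) (Suc n)
      = (\<Sum>((r, s), rs)\<in>(SIGMA (r, s):?P. ?Q r s). ?c ((r, s) # rs))"
    unfolding dynkin_length_part_def dynkin_index_length_Suc_Suc
    by (subst sum.reindex) (auto simp: inj_on_def case_prod_unfold)
  also have "\<dots> = (\<Sum>(r, s)\<in>?P. \<Sum>rs\<in>?Q r s. ?c ((r, s) # rs))"
    using fin unfolding case_prod_unfold by (subst sum.Sigma) (auto simp: finite_dynkin_index case_prod_unfold)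
  also have "\<dots> = (\<Sum>(r, s)\<in>?P. emb (1 / fact r) * (comm x ^^ r)
        (emb (1 / fact s) * (comm y ^^ s) (dynkin_length_part x y (Suc l) (Suc (n - (r + s))))))"
  proof (rule sum.cong[OF refl], clarify, goal_cases)
    case (1 r s)
    have "?c ((r, s) # rs) = emb (1 / fact r) * (comm x ^^ r) (emb (1 / fact s) * (comm y ^^ s) (?c rs))"
      if "rs \<in> ?Q r s" for rs
    proof -
      have "dynkin_word x y rs \<noteq> []"
        using that dynkin_word_eq_Nil[of rs "Suc (n - (r + s))" x y] by simp
      then have "nested_comm (dynkin_word x y ((r, s) # rs))
          = (comm x ^^ r) ((comm y ^^ s) (nested_comm (dynkin_word x y rs)))"
        by (simp add: dynkin_word_def nested_comm_replicate_append)
      moreover have "word_coeff ((r, s) # rs) = 1 / fact r * (1 / fact s * word_coeff rs)"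
        by (simp add: word_coeff_def)
      ultimately show ?thesis by (simp only: comm_pow_emb emb_mult mult.assoc)
    qed
    then show ?case
      unfolding dynkin_length_part_def by (simp add: comm_pow_sum sum_distrib_left)
  qed
  finally show ?thesis .
qed

text \<open>
  A bracket \<open>[x\<^sup>r y\<^sup>s]\<close> that ends in \<open>[y, y]\<close> or in \<open>[x, x]\<close> vanishes, which leaves \<open>s = 1\<close> and
  the bracket of the one-letter word \<open>x\<close>.
\<close>

lemma dynkin_length_part_1:
  "dynkin_length_part x y (Suc 0) (Suc n)
   = (if n = 0 then x else 0) + emb (1 / fact n) * (comm x ^^ n) y"
proof -
  let ?N = "\<lambda>r. emb (1 / (fact r * fact (Suc n - r))) * nested_comm (replicate r x @ replicate (Suc n - r) y)"
  have "{rs \<in> dynkin_index (Suc n). length rs = Suc 0} = (\<lambda>r. [(r, Suc n - r)]) ` {..Suc n}"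
    by (force simp: dynkin_index_def length_Suc_conv)
  then have "dynkin_length_part x y (Suc 0) (Suc n) = (\<Sum>r\<le>Suc n. ?N r)"
    unfolding dynkin_length_part_def
    by (simp only:) (subst sum.reindex, auto simp: inj_on_def dynkin_word_def word_coeff_def)
  also have "\<dots> = (\<Sum>r\<in>{n, Suc n}. ?N r)"
  proof (rule sum.mono_neutral_right)
    show "\<forall>r\<in>{..Suc n} - {n, Suc n}. ?N r = 0"
    proof
      fix r assume r: "r \<in> {..Suc n} - {n, Suc n}"
      then have "Suc n - r = Suc (Suc (n - Suc r))" by auto
      then show "?N r = 0"
        by (simp add: nested_comm_replicate_append nested_comm_replicate del: replicate_Suc)
    qed
  qed auto
  also have "?N n = emb (1 / fact n) * (comm x ^^ n) y"
    by (simp add: nested_comm_replicate_append)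
  moreover have "?N (Suc n) = (if n = 0 then x else 0)"
    using nested_comm_replicate[of "n - 1" x] by (cases n) (simp, simp del: replicate_Suc)
  ultimately show ?thesis by (simp add: add.commute)
qed

text \<open>
  The right-hand side is the recursion for lists of pairs in \<open>dynkin_length_part_Suc_Suc\<close>; the
  pair \<open>(0, 0)\<close>, which is excluded there, accounts for the identity that is subtracted here.
\<close>

lemma Ad_Ad_minus_id_nth:
  "(Ad x (Ad y F) - F) $ n = (\<Sum>(r, s) | 0 < r + s \<and> r + s \<le> n.
     emb (1 / fact r) * (comm x ^^ r) (emb (1 / fact s) * (comm y ^^ s) (F $ (n - (r + s)))))"
proof -
  let ?t = "\<lambda>r s. emb (1 / fact r) * (comm x ^^ r) (emb (1 / fact s) * (comm y ^^ s) (F $ (n - (r + s))))"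
  have "Ad x (Ad y F) $ n = (\<Sum>r\<le>n. \<Sum>s\<le>n - r. ?t r s)"
    unfolding Ad_nth[of x] Ad_nth[of y] by (simp add: comm_pow_sum sum_distrib_left)
  also have "\<dots> = (\<Sum>(r, s)\<in>(SIGMA r:{..n}. {..n - r}). ?t r s)"
    by (rule sum.Sigma) auto
  also have "(SIGMA r:{..n}. {..n - r}) = insert (0, 0) {(r, s). 0 < r + s \<and> r + s \<le> n}"
    by auto
  also have "(\<Sum>(r, s)\<in>\<dots>. ?t r s) = F $ n + (\<Sum>(r, s) | 0 < r + s \<and> r + s \<le> n. ?t r s)"
    by (subst sum.insert) (auto intro: finite_subset[of _ "{..n} \<times> {..n}"])
  finally show ?thesis by simp
qed

text \<open>
  The counterpart of \<open>bch_part\<close> in an associative ring.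
\<close>

definition dynkin_part :: "'a \<Rightarrow> 'a \<Rightarrow> nat \<Rightarrow> 'a" where
  "dynkin_part x y n = (\<Sum>rs\<in>dynkin_index n.
     emb ((-1) ^ (length rs + 1)
            / (of_nat (length rs) * of_nat n * (\<Prod>(r, s)\<leftarrow>rs. fact r * fact s)))
       * nested_comm (dynkin_word x y rs))"

lemma dynkin_part_conv_length_part:
  "of_nat (Suc n) * dynkin_part x y (Suc n)
    = (\<Sum>l\<le>n. emb ((-1) ^ l / of_nat (Suc l)) * dynkin_length_part x y (Suc l) (Suc n))"
proof -
  let ?c = "\<lambda>rs. emb ((-1) ^ (length rs + 1) / of_nat (length rs)) * (emb (word_coeff rs) * nested_comm (dynkin_word x y rs))"
  have len: "length rs \<le> k" if "rs \<in> dynkin_index k" for rs k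
  proof -
    have "(\<forall>(r, s)\<in>set rs. r + s > 0) \<Longrightarrow> length rs \<le> (\<Sum>(r, s)\<leftarrow>rs. r + s)"
      by (induction rs) auto
    then show ?thesis using that by (simp add: dynkin_index_def)
  qed
  have "of_nat (Suc n) * ((-1) ^ (length rs + 1) / (of_nat (length rs) * of_nat (Suc n) * (\<Prod>(r, s)\<leftarrow>rs. fact r * fact s)))
      = (-1) ^ (length rs + 1) / of_nat (length rs) * word_coeff rs" for rs
    by (simp add: word_coeff_def del: of_nat_Suc)
  then have "of_nat (Suc n) * dynkin_part x y (Suc n) = (\<Sum>rs\<in>dynkin_index (Suc n). ?c rs)"
    unfolding dynkin_part_def sum_distrib_left of_nat_mult_emb by (simp only: emb_mult mult.assoc)
  also have "\<dots> = (\<Sum>l\<in>Suc ` {..n}. \<Sum>rs | rs \<in> dynkin_index (Suc n) \<and> length rs = l. ?c rs)"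
  proof (rule sum.group[symmetric])
    show "length ` dynkin_index (Suc n) \<subseteq> Suc ` {..n}"
    proof clarify
      fix rs assume "rs \<in> dynkin_index (Suc n)"
      then show "length rs \<in> Suc ` {..n}" using len[of rs "Suc n"] by (cases rs) (auto simp: dynkin_index_def)
    qed
  qed (simp_all add: finite_dynkin_index)
  also have "\<dots> = (\<Sum>l\<le>n. \<Sum>rs | rs \<in> dynkin_index (Suc n) \<and> length rs = Suc l. ?c rs)"
    by (subst sum.reindex) simp_all
  also have "\<dots> = (\<Sum>l\<le>n. emb ((-1) ^ l / of_nat (Suc l)) * dynkin_length_part x y (Suc l) (Suc n))"
    unfolding dynkin_length_part_def sum_distrib_left
    by (intro sum.cong refl) (auto simp del: of_nat_Suc)
  finally show ?thesis .
qed

text \<open>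
  Dynkin's form of the Baker--Campbell--Hausdorff formula. Both sides, multiplied by \<open>n\<close>, are the
  coefficient of \<open>t\<^sup>n\<^sup>-\<^sup>1\<close> in the derivative of the logarithm: on the left by definition, on the
  right because conjugation by \<open>W\<close> minus the identity adds one pair to the lists.
\<close>

theorem log_fexp_fexp_nth:
  assumes "n > 0"
  shows "subst (fps_ln 1) (fexp x * fexp y - 1) $ n = dynkin_part x y n"
proof -
  define U where "U = fexp x * fexp y - 1"
  define V where "V = fexp (- y) * fexp (- x)"
  obtain m where n: "n = Suc m" using assms by (cases n) auto
  have U0: "U $ 0 = 0" by (simp add: U_def fexp_nth)
  have W: "1 + U = fexp x * fexp y" by (simp add: U_def)
  have "V * (1 + U) = fexp (- y) * (fexp (- x) * fexp x) * fexp y"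
    by (simp only: W V_def mult.assoc)
  then have VW: "V * (1 + U) = 1" by (simp add: fexp_inverse')
  have "(1 + U) * V = fexp x * (fexp y * fexp (- y)) * fexp (- x)"
    by (simp only: W V_def mult.assoc)
  then have WV: "(1 + U) * V = 1" by (simp add: fexp_inverse)
  have AdAd: "(1 + U) * F * V = Ad x (Ad y F)" for F
    unfolding W V_def Ad_def by (simp only: mult.assoc)
  have base: "fps_deriv U * V = fps_const x + Ad x (fps_const y)"
  proof -
    have "fps_deriv U = fps_const x * (1 + U) + fexp x * fps_const y * fexp y"
      unfolding W by (simp add: U_def fps_deriv_fexp mult.assoc add.commute)
    moreover have "fexp x * fps_const y * fexp y * V = fexp x * fps_const y * (fexp y * fexp (- y)) * fexp (- x)"
      by (simp only: V_def mult.assoc)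
    then have "fexp x * fps_const y * fexp y * V = Ad x (fps_const y)"
      by (simp add: Ad_def fexp_inverse)
    ultimately show ?thesis
      using WV by (simp add: distrib_right mult.assoc)
  qed
  \<comment> \<open>the index \<open>m\<close> belongs to word length \<open>m + 1\<close>, as the derivative lowers degrees by one\<close>
  have iter: "((\<lambda>F. (1 + U) * F * V - F) ^^ l) (fps_deriv U * V) $ m = dynkin_length_part x y (Suc l) (Suc m)" for l m
  proof (induction l arbitrary: m)
    case 0
    show ?case
      unfolding dynkin_length_part_1 funpow_0 base by (simp add: Ad_const_nth)
  next
    case (Suc l)
    show ?case
      unfolding dynkin_length_part_Suc_Suc funpow.simps comp_apply AdAd Ad_Ad_minus_id_nth
      using Suc unfolding AdAd by (intro sum.cong refl) (auto simp: case_prod_unfold)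
  qed
  have "of_nat n * subst (fps_ln 1) U $ n = fps_deriv (subst (fps_ln 1) U) $ m"
    by (simp add: n)
  also have "\<dots> = of_nat n * dynkin_part x y n"
    unfolding deriv_log_nth[OF U0 VW] conj_minus_id_pow[OF VW WV, symmetric] iter n
      dynkin_part_conv_length_part ..
  finally show ?thesis
    unfolding U_def using assms by (rule of_nat_mult_cancel[rotated])
qed

end

section \<open>Truncated exponentials in a filtered ring\<close>

text \<open>
  A decreasing filtration by additive subgroups, compatible with products and scalars. Then every
  \<open>J n\<close> is a two-sided ideal of \<open>J 0\<close>, and working modulo \<open>J n\<close> replaces convergence.
\<close>

locale filtered_rat_algebra = rat_algebra emb for emb :: "rat \<Rightarrow> 'a::ring_1" +
  fixes J :: "nat \<Rightarrow> 'a set"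
  assumes J_0 [simp]: "0 \<in> J n"
    and J_diff: "a \<in> J n \<Longrightarrow> b \<in> J n \<Longrightarrow> a - b \<in> J n"
    and J_mult: "a \<in> J m \<Longrightarrow> b \<in> J n \<Longrightarrow> a * b \<in> J (m + n)"
    and J_emb: "emb c \<in> J 0"
    and J_Suc: "J (Suc n) \<subseteq> J n"
begin

lemma J_minus: "a \<in> J n \<Longrightarrow> - a \<in> J n"
  using J_diff[of 0 n a] by simp

lemma J_add: "a \<in> J n \<Longrightarrow> b \<in> J n \<Longrightarrow> a + b \<in> J n"
  using J_diff[of a n "- b"] by (simp add: J_minus)

lemma J_sum: "(\<And>i. i \<in> S \<Longrightarrow> f i \<in> J n) \<Longrightarrow> sum f S \<in> J n"
  by (induction S rule: infinite_finite_induct) (auto intro: J_add)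

lemma J_mono: "m \<le> n \<Longrightarrow> a \<in> J n \<Longrightarrow> a \<in> J m"
  using lift_Suc_antimono_le[of J m n] J_Suc by blast

lemma J_emb_mult: "a \<in> J n \<Longrightarrow> emb c * a \<in> J n"
  using J_mult[OF J_emb, of a n c] by simp

lemma J_power: "a \<in> J m \<Longrightarrow> a ^ n \<in> J (m * n)"
proof (induction n)
  case (Suc n)
  then show ?case using J_mult[of a m "a ^ n" "m * n"] by simp
qed (use J_emb[of 1] in simp)

lemma J_cong_mult:
  assumes "a \<in> J 0" "b' \<in> J 0" "a - a' \<in> J n" "b - b' \<in> J n"
  shows "a * b - a' * b' \<in> J n"
proof -
  have "a * b - a' * b' = a * (b - b') + (a - a') * b'"
    by (simp add: algebra_simps)
  then show ?thesis
    using assms J_mult[of a 0 "b - b'" n] J_mult[of "a - a'" n b' 0] by (auto intro: J_add)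
qed

lemma J_cong_power:
  assumes "a \<in> J 0" "b \<in> J 0" "a - b \<in> J n"
  shows "a ^ i - b ^ i \<in> J n"
proof (induction i)
  case (Suc i)
  then show ?case
    using J_cong_mult[of a "b ^ i" b n "a ^ i"] assms J_power[of b 0 i] by simp
qed simp

text \<open>
  The coefficients from the \<open>N\<close>-th on lie in \<open>J N\<close>, so that \<open>trunc N\<close> plays the role of the value
  at \<open>t = 1\<close> modulo \<open>J N\<close>; as such it is multiplicative (\<open>trunc_mult\<close>).
\<close>

definition homogeneous_bounded :: "'a fps \<Rightarrow> bool" where
  "homogeneous_bounded F \<longleftrightarrow> (\<forall>n. F $ n \<in> J n)"

definition trunc :: "nat \<Rightarrow> 'a fps \<Rightarrow> 'a" where
  "trunc N F = (\<Sum>n<N. F $ n)"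

lemma homogeneous_bounded_mult:
  "homogeneous_bounded F \<Longrightarrow> homogeneous_bounded G \<Longrightarrow> homogeneous_bounded (F * G)"
  unfolding homogeneous_bounded_def fps_mult_nth
proof (intro allI J_sum)
  fix n i :: nat assume *: "\<forall>n. F $ n \<in> J n" "\<forall>n. G $ n \<in> J n" "i \<in> {0..n}"
  then show "F $ i * G $ (n - i) \<in> J n"
    using J_mult[of "F $ i" i "G $ (n - i)" "n - i"] by simp
qed

lemma homogeneous_bounded_power: "homogeneous_bounded F \<Longrightarrow> homogeneous_bounded (F ^ n)"
proof (induction n)
  case 0
  then show ?case using J_emb[of 1] by (simp add: homogeneous_bounded_def)
qed (simp add: homogeneous_bounded_mult)

lemma trunc_in_J_0: "homogeneous_bounded F \<Longrightarrow> trunc N F \<in> J 0"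
  unfolding trunc_def homogeneous_bounded_def by (intro J_sum) (auto intro: J_mono[OF le0])

lemma trunc_mult:
  assumes "homogeneous_bounded F" "homogeneous_bounded G"
  shows "trunc N (F * G) - trunc N F * trunc N G \<in> J N"
proof -
  let ?t = "\<lambda>(i, j). F $ i * G $ j"
  have "trunc N (F * G) = (\<Sum>p\<in>{(i, j). i + j < N}. ?t p)"
    unfolding trunc_def fps_mult_nth
    by (subst sum.triangle_reindex) (simp add: atMost_atLeast0)
  moreover have "trunc N F * trunc N G = (\<Sum>p\<in>{..<N} \<times> {..<N}. ?t p)"
    by (simp add: trunc_def sum_product sum.cartesian_product)
  moreover have "\<dots> = (\<Sum>p\<in>{..<N} \<times> {..<N} - {(i, j). i + j < N}. ?t p) + (\<Sum>p\<in>{(i, j). i + j < N}. ?t p)"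
    by (rule sum.subset_diff) auto
  ultimately have "trunc N (F * G) - trunc N F * trunc N G = - (\<Sum>p\<in>{..<N} \<times> {..<N} - {(i, j). i + j < N}. ?t p)"
    by simp
  also have "\<dots> \<in> J N"
  proof (intro J_minus J_sum, clarsimp)
    fix i j assume "\<not> i + j < N"
    then show "F $ i * G $ j \<in> J N"
      using assms J_mult[of "F $ i" i "G $ j" j] J_mono[of N "i + j"]
      by (simp add: homogeneous_bounded_def)
  qed
  finally show ?thesis .
qed

lemma trunc_power:
  assumes "homogeneous_bounded F"
  shows "trunc (Suc N) (F ^ i) - trunc (Suc N) F ^ i \<in> J (Suc N)"
proof (induction i)
  case 0
  have "trunc (Suc N) (F ^ 0) = (\<Sum>n<Suc N. if n = 0 then 1 else 0)"
    unfolding trunc_def by (intro sum.cong) auto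
  also have "\<dots> = 1" by (subst sum.delta) auto
  finally show ?case by simp
next
  case (Suc i)
  let ?T = "trunc (Suc N)"
  have "?T (F ^ Suc i) - ?T F * ?T (F ^ i) \<in> J (Suc N)"
    using trunc_mult[OF assms homogeneous_bounded_power[OF assms]] by simp
  moreover have "?T F * ?T (F ^ i) - ?T F * ?T F ^ i \<in> J (Suc N)"
    using Suc J_mult[OF trunc_in_J_0[OF assms] Suc, of "Suc N"] by (simp add: right_diff_distrib)
  ultimately have "?T (F ^ Suc i) - ?T F * ?T (F ^ i) + (?T F * ?T (F ^ i) - ?T F * ?T F ^ i) \<in> J (Suc N)"
    by (rule J_add)
  then show ?case by simp
qed

definition texp :: "nat \<Rightarrow> 'a \<Rightarrow> 'a" where
  "texp N z = (\<Sum>n<N. emb (1 / fact n) * z ^ n)"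

lemma trunc_fexp: "trunc N (fexp z) = texp N z"
  by (simp add: trunc_def texp_def fexp_nth)

lemma homogeneous_bounded_fexp: "z \<in> J 1 \<Longrightarrow> homogeneous_bounded (fexp z)"
  using J_power[of z 1] by (simp add: homogeneous_bounded_def fexp_nth J_emb_mult)

lemma texp_in_J_0: "z \<in> J 1 \<Longrightarrow> texp N z \<in> J 0"
  by (simp add: trunc_in_J_0 homogeneous_bounded_fexp flip: trunc_fexp)

lemma texp_minus_1:
  assumes "z \<in> J 1"
  shows "texp (Suc N) z - 1 \<in> J 1"
proof -
  have "texp (Suc N) z - 1 = (\<Sum>n<N. emb (1 / fact (Suc n)) * z ^ Suc n)"
    unfolding texp_def by (subst sum.lessThan_Suc_shift) simp
  also have "\<dots> \<in> J 1"
    using J_power[OF assms] by (intro J_sum J_emb_mult) (metis J_mono Suc_leI mult_1 zero_less_Suc One_nat_def)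
  finally show ?thesis .
qed

lemma nested_comm_in_J: "set w \<subseteq> J 1 \<Longrightarrow> nested_comm w \<in> J (length w)"
proof (induction w rule: nested_comm.induct)
  case (3 x y zs)
  then have "x \<in> J 1" "nested_comm (y # zs) \<in> J (length (y # zs))" by simp_all
  then show ?case
    using J_mult[of x 1 "nested_comm (y # zs)" "length (y # zs)"] J_mult[of "nested_comm (y # zs)" "length (y # zs)" x 1]
    by (simp add: comm_def J_diff)
qed simp_all

lemma dynkin_part_in_J:
  assumes "x \<in> J 1" "y \<in> J 1"
  shows "dynkin_part x y n \<in> J n"
  unfolding dynkin_part_def
proof (intro J_sum J_emb_mult)
  fix rs assume "rs \<in> dynkin_index n"
  then show "nested_comm (dynkin_word x y rs) \<in> J n"
    using assms nested_comm_in_J[of "dynkin_word x y rs"] set_dynkin_word[of x y rs]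
    by (auto simp: length_dynkin_word)
qed

text \<open>
  Setting \<open>t = 1\<close> in \<open>exp Z = exp (t x) exp (t y)\<close>, where \<open>Z\<close> is Dynkin's series. The element \<open>z\<close>
  stands for the sum of that series at \<open>t = 1\<close>, of which only the class modulo \<open>J (N + 1)\<close>
  matters.
\<close>

theorem texp_dynkin:
  assumes x: "x \<in> J 1" and y: "y \<in> J 1" and z: "z \<in> J 0"
    and z_approx: "z - (\<Sum>n<N. dynkin_part x y (Suc n)) \<in> J (Suc N)"
  shows "texp (Suc N) z - texp (Suc N) x * texp (Suc N) y \<in> J (Suc N)"
proof -
  let ?T = "trunc (Suc N)"
  define U where "U = fexp x * fexp y - 1"
  define Z where "Z = subst (fps_ln 1) U"
  have U0: "U $ 0 = 0" by (simp add: U_def fexp_nth)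
  have Z0: "Z $ 0 = 0" by (simp add: Z_def subst_nth_0)
  have Zn: "Z $ n = dynkin_part x y n" if "n > 0" for n
    unfolding Z_def U_def using that by (rule log_fexp_fexp_nth)
  have bd: "homogeneous_bounded Z"
    unfolding homogeneous_bounded_def
  proof
    fix n show "Z $ n \<in> J n"
      using Z0 Zn[of n] dynkin_part_in_J[OF x y, of n] by (cases n) auto
  qed
  have "?T Z = (\<Sum>n<N. dynkin_part x y (Suc n))"
    unfolding trunc_def by (subst sum.lessThan_Suc_shift) (simp add: Z0 Zn)
  with z_approx have zZ: "z - ?T Z \<in> J (Suc N)" by simp
  have "texp (Suc N) z - (\<Sum>i<Suc N. emb (1 / fact i) * ?T (Z ^ i)) \<in> J (Suc N)"
  proof -
    have "z ^ i - ?T (Z ^ i) \<in> J (Suc N)" for i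
      using J_diff[OF J_cong_power[OF z trunc_in_J_0[OF bd] zZ, of i] trunc_power[OF bd, of N i]] by simp
    then have "(\<Sum>i<Suc N. emb (1 / fact i) * (z ^ i - ?T (Z ^ i))) \<in> J (Suc N)"
      by (intro J_sum J_emb_mult)
    then show ?thesis
      by (simp only: texp_def right_diff_distrib sum_subtractf)
  qed
  moreover have "(\<Sum>i<Suc N. emb (1 / fact i) * ?T (Z ^ i)) = ?T (fexp x * fexp y)"
  proof -
    have "(\<Sum>i<Suc N. emb (1 / fact i) * ?T (Z ^ i)) = (\<Sum>n<Suc N. \<Sum>i<Suc N. emb (1 / fact i) * Z ^ i $ n)"
      unfolding trunc_def sum_distrib_left by (rule sum.swap)
    also have "\<dots> = ?T (subst (fps_exp 1) Z)"
      unfolding trunc_def lessThan_Suc_atMost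
      by (intro sum.cong refl) (simp add: subst_nth_upto[OF Z0, of _ N])
    also have "subst (fps_exp 1) Z = fexp x * fexp y"
      unfolding Z_def exp_log[OF U0] by (simp add: U_def)
    finally show ?thesis .
  qed
  moreover have "?T (fexp x * fexp y) - texp (Suc N) x * texp (Suc N) y \<in> J (Suc N)"
    using trunc_mult[OF homogeneous_bounded_fexp[OF x] homogeneous_bounded_fexp[OF y], of "Suc N"]
    by (simp add: trunc_fexp)
  ultimately show ?thesis
    using J_add by fastforce
qed

end

section \<open>Additive endomorphisms as a ring\<close>

text \<open>
  The endomorphisms of the zero group do not form a ring with \<open>0 \<noteq> 1\<close>, as the type class of rings
  with unit requires. Pairs with a second component from a field are always admissible.
\<close>

class nonzero_ab_group_add = ab_group_add +
  assumes ex_nonzero: "\<exists>x. x \<noteq> 0"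

instance prod :: (ab_group_add, field) nonzero_ab_group_add
proof
  have "(0, 1) \<noteq> (0 :: 'a \<times> 'b)" by (simp add: zero_prod_def)
  then show "\<exists>x. x \<noteq> (0 :: 'a \<times> 'b)" by blast
qed

typedef (overloaded) 'v endo = "{f :: 'v::ab_group_add \<Rightarrow> 'v. \<forall>x y. f (x + y) = f x + f y}"
  morphisms app Endo
  by (rule exI[of _ id]) simp

setup_lifting type_definition_endo

lemma app_add: "app a (x + y) = app a x + app a y"
  using app[of a] by simp

instantiation endo :: (nonzero_ab_group_add) ring_1
begin

lift_definition zero_endo :: "'a endo" is "\<lambda>_. 0" by simp
lift_definition one_endo :: "'a endo" is "\<lambda>x. x" by simp
lift_definition plus_endo :: "'a endo \<Rightarrow> 'a endo \<Rightarrow> 'a endo" is "\<lambda>f g x. f x + g x"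
  by (simp add: algebra_simps)
lift_definition uminus_endo :: "'a endo \<Rightarrow> 'a endo" is "\<lambda>f x. - f x"
  by simp
lift_definition minus_endo :: "'a endo \<Rightarrow> 'a endo \<Rightarrow> 'a endo" is "\<lambda>f g x. f x - g x"
  by (simp add: algebra_simps)
lift_definition times_endo :: "'a endo \<Rightarrow> 'a endo \<Rightarrow> 'a endo" is "\<lambda>f g x. f (g x)"
  by simp

instance
proof
  fix a b c :: "'a endo"
  show "a + b + c = a + (b + c)" by transfer (simp add: add.assoc)
  show "a + b = b + a" by transfer (simp add: add.commute)
  show "0 + a = a" by transfer simp
  show "- a + a = 0" by transfer simp
  show "a - b = a + - b" by transfer simp
  show "a * b * c = a * (b * c)" by transfer simp
  show "1 * a = a" by transfer simp
  show "a * 1 = a" by transfer simp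
  show "(a + b) * c = a * c + b * c" by transfer simp
  show "a * (b + c) = a * b + a * c" by transfer simp
  show "(0 :: 'a endo) \<noteq> 1" by transfer (metis ex_nonzero)
qed

end

lemma app_simps [simp]:
  "app 0 x = 0" "app 1 x = x" "app (a + b) x = app a x + app b x" "app (- a) x = - app a x"
  "app (a - b) x = app a x - app b x" "app (a * b) x = app a (app b x)"
  by (transfer, simp)+

lemma app_0 [simp]: "app a 0 = 0"
  using app_add[of a 0 0] by simp

lemma app_diff: "app a (x - y) = app a x - app a y"
  using app_add[of a "x - y" y] by (simp add: algebra_simps)

lemma app_sum: "app (sum f S) x = (\<Sum>i\<in>S. app (f i) x)"
  by (induction S rule: infinite_finite_induct) simp_all

lemma app_power: "app (a ^ n) x = (app a ^^ n) x"
  by (induction n) simp_all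

section \<open>Limits in the filtration topology\<close>

context complete_filtered_dgla
begin

sublocale vs: vector_space "scal L"
  by (rule vector_space)

lemma linear_rules:
  assumes "Vector_Spaces.linear (scal L) (scal L) f"
  shows linear_add: "f (x + y) = f x + f y" and linear_scal: "f (scal L c x) = scal L c (f x)"
    and linear_0: "f 0 = 0" and linear_diff: "f (x - y) = f x - f y"
    and linear_minus: "f (- x) = - f x" and linear_sum: "f (sum h S) = (\<Sum>i\<in>S. f (h i))"
proof -
  interpret f: Vector_Spaces.linear "scal L" "scal L" f by (rule assms)
  show "f (x + y) = f x + f y" "f (scal L c x) = scal L c (f x)" "f 0 = 0" "f (x - y) = f x - f y"
    "f (- x) = - f x" "f (sum h S) = (\<Sum>i\<in>S. f (h i))"
    by (fact f.add f.scale f.zero f.diff f.neg f.sum)+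
qed

lemmas dif_simps = linear_rules[OF dif_linear]
lemmas brk_right_simps = linear_rules[OF brk_linear_right]
lemmas brk_left_simps = linear_rules[OF brk_linear_left]

lemma Fil_subspace: "r \<ge> 1 \<Longrightarrow> vs.subspace (Fil L r)"
  using Fil_graded_subspace[of r] vs.subspace_span by metis

lemma FD_subspace: "r \<ge> 1 \<Longrightarrow> vs.subspace (FD L r n)"
  unfolding FD_def by (intro vs.subspace_inter Fil_subspace Deg_subspace)

lemma Fil_mono: "1 \<le> r \<Longrightarrow> r \<le> s \<Longrightarrow> Fil L s \<subseteq> Fil L r"
proof (induction s)
  case (Suc s)
  then show ?case using Fil_decreasing[of s] by (cases "r = Suc s") auto
qed simp

lemma in_Fil_1 [simp]: "x \<in> Fil L (Suc 0)"
  using Fil_1 by simp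

lemma coset_eq_iff:
  assumes "vs.subspace H"
  shows "x +o H = y +o H \<longleftrightarrow> x - y \<in> H"
proof
  assume "x +o H = y +o H"
  then have "x \<in> y +o H"
    using vs.subspace_0[OF assms] set_plus_intro2[of 0 H x] by simp
  then show "x - y \<in> H" by (simp add: set_minus_plus)
next
  assume *: "x - y \<in> H"
  have "u +o H \<subseteq> v +o H" if "u - v \<in> H" for u v
  proof
    fix w assume "w \<in> u +o H"
    then have "w - u \<in> H" by (simp add: set_minus_plus)
    then have "(w - u) + (u - v) \<in> H" using that by (rule vs.subspace_add[OF assms])
    then show "w \<in> v +o H" by (simp add: set_minus_plus)
  qed
  moreover have "y - x \<in> H" using vs.subspace_neg[OF assms *] by simp
  ultimately show "x +o H = y +o H" using * by blast
qed

lemma coset_plus_subspace: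
  assumes "vs.subspace H" "K \<subseteq> H" "0 \<in> K"
  shows "(x +o K) + H = x +o H"
proof -
  have "K + H = H"
    using assms vs.subspace_add[OF assms(1)] by (auto simp: set_plus_def) (metis add_0)
  then show ?thesis by (simp add: set_plus_rearrange3)
qed

text \<open>
  Additive maps are determined by their values on homogeneous elements. The sign rules of the DGLA
  are available only for such elements.
\<close>

lemma homogeneous_eqI:
  assumes "\<And>x y. f (x + y) = f x + f y" "\<And>x y. g (x + y) = g x + (g y :: 'g)"
    and eq: "\<And>n x. x \<in> Deg L n \<Longrightarrow> f x = g x"
  shows "f x = g x"
proof -
  obtain c where c: "\<And>n. c n \<in> Deg L n" "x = (\<Sum>n | c n \<noteq> 0. c n)"
    using Deg_direct_sum[of x] by blast
  have "f 0 = 0" "g 0 = 0" using assms(1,2)[of 0 0] by simp_all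
  then have "f (sum c A) = (\<Sum>n\<in>A. f (c n))" "g (sum c A) = (\<Sum>n\<in>A. g (c n))" for A
    by (induction A rule: infinite_finite_induct) (simp_all add: assms(1,2))
  moreover have "f (c n) = g (c n)" for n using c(1) by (rule eq)
  ultimately show ?thesis unfolding c(2) by simp
qed

lemma Fil_decomposition:
  assumes "r \<ge> 1" "x \<in> Fil L r"
  shows "\<exists>c. (\<forall>n. c n \<in> FD L r n) \<and> finite {n. c n \<noteq> 0} \<and> x = (\<Sum>n | c n \<noteq> 0. c n)"
proof -
  note S = FD_subspace[OF assms(1)]
  let ?D = "\<lambda>x A c. (\<forall>n. c n \<in> FD L r n) \<and> finite A \<and> (\<forall>n. n \<notin> A \<longrightarrow> c n = 0) \<and> x = sum c A"
  have "vs.subspace {x. \<exists>A c. ?D x A c}"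
  proof (rule vs.subspaceI, goal_cases)
    case 1
    have "?D 0 {} (\<lambda>_. 0)" using vs.subspace_0[OF S] by simp
    then show ?case by (intro CollectI exI)
  next
    case (2 x y)
    then obtain A c B d where *: "?D x A c" "?D y B d" by blast
    then have "x = sum c (A \<union> B)" "y = sum d (A \<union> B)"
      by (auto intro!: sum.mono_neutral_left)
    with * have "?D (x + y) (A \<union> B) (\<lambda>n. c n + d n)"
      using vs.subspace_add[OF S] by (auto simp: sum.distrib)
    then show ?case by (intro CollectI exI)
  next
    case (3 k x)
    then obtain A c where "?D x A c" by blast
    then have "?D (scal L k x) A (\<lambda>n. scal L k (c n))"
      using vs.subspace_scale[OF S] by (auto simp: vs.scale_sum_right)
    then show ?case by (intro CollectI exI)
  qed
  moreover have "(\<Union>n. FD L r n) \<subseteq> {x. \<exists>A c. ?D x A c}"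
  proof clarify
    fix x n assume "x \<in> FD L r n"
    then have "?D x {n} (\<lambda>i. if i = n then x else 0)"
      using vs.subspace_0[OF S] by simp
    then show "\<exists>A c. ?D x A c" by (intro exI)
  qed
  ultimately have "vs.span (\<Union>n. FD L r n) \<subseteq> {x. \<exists>A c. ?D x A c}"
    by (intro vs.span_minimal)
  then obtain A c where c: "?D x A c" using assms Fil_graded_subspace by blast
  then have "{n. c n \<noteq> 0} \<subseteq> A" by auto
  then have "finite {n. c n \<noteq> 0}" "x = (\<Sum>n | c n \<noteq> 0. c n)"
    using c by (auto intro: finite_subset sum.mono_neutral_right)
  then show ?thesis using c by blast
qed

text \<open>
  Completeness is stated degree by degree. The homogeneous components of an element of \<open>Fil L r\<close>
  lie in \<open>Fil L r\<close> too, and by injectivity of the map to the inverse limit a component that lies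
  in every \<open>Fil L r\<close> is zero.
\<close>

lemma Inter_Fil:
  assumes "\<And>r. r \<ge> 1 \<Longrightarrow> x \<in> Fil L r"
  shows "x = 0"
proof -
  obtain c where c: "\<forall>n. c n \<in> Deg L n" "finite {n. c n \<noteq> 0}" "x = (\<Sum>n | c n \<noteq> 0. c n)"
    and unique: "\<And>d. (\<forall>n. d n \<in> Deg L n) \<and> finite {n. d n \<noteq> 0} \<and> x = (\<Sum>n | d n \<noteq> 0. d n) \<Longrightarrow> d = c"
    using Deg_direct_sum[of x] by blast
  have "c n = 0" for n
  proof -
    have mem: "c n \<in> FD L r n" if r: "r \<ge> 1" for r
    proof -
      obtain d where "\<forall>n. d n \<in> FD L r n" "finite {n. d n \<noteq> 0}" "x = (\<Sum>n | d n \<noteq> 0. d n)"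
        using Fil_decomposition[OF r assms[OF r]] by blast
      moreover from this have "d = c" by (intro unique) (auto simp: FD_def)
      ultimately show ?thesis by blast
    qed
    have "c n +o FD L r n = 0 +o FD L r n" if "r \<ge> 1" for r
      using that mem by (subst coset_eq_iff) (auto intro: FD_subspace)
    then have "(\<lambda>r\<in>{1..}. c n +o FD L r n) = (\<lambda>r\<in>{1..}. 0 +o FD L r n)"
      by (intro restrict_ext) auto
    then show ?thesis
      using Fil_complete[of n] c(1) vs.subspace_0[OF Deg_subspace]
      unfolding bij_betw_def inj_on_def by blast
  qed
  then show ?thesis using c(3) by simp
qed

text \<open>
  Modulo \<open>Fil L (N + 1)\<close> the partial sums are constant from the one with \<open>N\<close> terms onwards, so
  they form an element of the inverse limit; \<open>s\<close> is its preimage.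
\<close>

lemma exists_limit:
  assumes a: "\<And>i. a i \<in> FD L (Suc i) n"
  shows "\<exists>s\<in>Deg L n. \<forall>N. (\<Sum>i<N. a i) - s \<in> Fil L (Suc N)"
proof -
  define S where "S N = (\<Sum>i<N. a i)" for N
  have S: "S N \<in> Deg L n" for N
    unfolding S_def using a by (intro vs.subspace_sum Deg_subspace) (auto simp: FD_def)
  let ?c = "\<lambda>r\<in>{1..}. S (r - 1) +o FD L r n"
  have "?c \<in> inverse_limit L n"
    unfolding inverse_limit_def quotients_def
  proof (intro CollectI conjI allI impI restrict_PiE_iff[THEN iffD2] ballI imageI S)
    fix r :: nat assume r: "1 \<le> r"
    then obtain m where m: "r = Suc m" by (cases r) auto
    have "(S r +o FD L (Suc r) n) + FD L r n = S r +o FD L r n"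
      using r Fil_decreasing vs.subspace_0[OF FD_subspace[of "Suc r"]]
      by (intro coset_plus_subspace FD_subspace) (auto simp: FD_def)
    also have "\<dots> = S (r - 1) +o FD L r n"
      using r a[of m] by (subst coset_eq_iff[OF FD_subspace]) (auto simp: S_def m)
    finally show "?c (Suc r) + FD L r n = ?c r" using r by simp
  qed
  then obtain s where s: "s \<in> Deg L n" "(\<lambda>r\<in>{1..}. s +o FD L r n) = ?c"
    using Fil_complete[of n] unfolding bij_betw_def by (metis (no_types, lifting) imageE)
  have "S N - s \<in> Fil L (Suc N)" for N
  proof -
    have "s +o FD L (Suc N) n = S N +o FD L (Suc N) n"
      using fun_cong[OF s(2), of "Suc N"] by simp
    then have "S N +o FD L (Suc N) n = s +o FD L (Suc N) n" ..
    then show ?thesis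
      by (subst (asm) coset_eq_iff[OF FD_subspace]) (auto simp: FD_def)
  qed
  then show ?thesis using s(1) unfolding S_def by blast
qed

lemma fil_suminf_eqI:
  assumes "fil_sums L a s"
  shows "fil_suminf L a = s"
  unfolding fil_suminf_def
proof (rule the_equality, rule assms)
  fix t assume t: "fil_sums L a t"
  have "t - s = 0"
  proof (rule Inter_Fil)
    fix r :: nat assume r: "r \<ge> 1"
    obtain M N where "\<forall>n\<ge>M. (\<Sum>i<n. a i) - s \<in> Fil L r" "\<forall>n\<ge>N. (\<Sum>i<n. a i) - t \<in> Fil L r"
      using assms t r unfolding fil_sums_def by blast
    then have "((\<Sum>i<max M N. a i) - s) - ((\<Sum>i<max M N. a i) - t) \<in> Fil L r"
      by (intro vs.subspace_diff[OF Fil_subspace[OF r], of "sum _ _ - _" "sum _ _ - _"]) auto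
    then show "t - s \<in> Fil L r" by simp
  qed
  then show "t = s" by simp
qed

lemma fil_suminf_approx:
  assumes "\<And>i. a i \<in> FD L (Suc i) n"
  shows "fil_suminf L a \<in> Deg L n" "(\<Sum>i<N. a i) - fil_suminf L a \<in> Fil L (Suc N)"
proof -
  obtain s where s: "s \<in> Deg L n" "\<And>N. (\<Sum>i<N. a i) - s \<in> Fil L (Suc N)"
    using exists_limit[OF assms] by blast
  have "fil_sums L a s"
    unfolding fil_sums_def
  proof (intro allI impI)
    fix r :: nat assume "r \<ge> 1"
    then show "\<exists>N. \<forall>n\<ge>N. (\<Sum>i<n. a i) - s \<in> Fil L r"
      using s(2) Fil_mono[of r] by (intro exI[of _ r]) (meson le_SucI subsetD)
  qed
  then have "fil_suminf L a = s" by (rule fil_suminf_eqI)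
  with s show "fil_suminf L a \<in> Deg L n" "(\<Sum>i<N. a i) - fil_suminf L a \<in> Fil L (Suc N)"
    by simp_all
qed

section \<open>Adjoining the differential as an inner derivation\<close>

text \<open>
  A pair \<open>(x, c)\<close> stands for \<open>x + c d\<close>, where \<open>d\<close> is an adjoined element of degree 1 with
  \<open>[p, d] = - \<delta>p\<close> for \<open>p\<close> of degree 0. All operators act on this enlarged space.
\<close>

definition scal_op :: "rat \<Rightarrow> ('g \<times> 'k) endo" where
  "scal_op c = Endo (\<lambda>(x, d). (scal L (of_rat c) x, of_rat c * d))"

definition ad_op :: "'g \<Rightarrow> ('g \<times> 'k) endo" where
  "ad_op p = Endo (\<lambda>(x, c). (brk L p x - scal L c (dif L p), 0))"

lemma app_scal_op: "app (scal_op c) (x, d) = (scal L (of_rat c) x, of_rat c * d)"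
  unfolding scal_op_def
  by (subst Endo_inverse) (auto simp: vs.scale_right_distrib distrib_left)

lemma app_ad_op: "app (ad_op p) (x, c) = (brk L p x - scal L c (dif L p), 0)"
  unfolding ad_op_def
  by (subst Endo_inverse) (auto simp: brk_right_simps vs.scale_left_distrib)

lemma endo_eqI: "(\<And>x c. app a (x, c) = app b (x, c)) \<Longrightarrow> a = b"
  using app_inject[of a b] by auto

lemma ad_op_add: "ad_op (p + q) = ad_op p + ad_op q"
  by (rule endo_eqI) (simp add: app_ad_op brk_left_simps dif_simps vs.scale_right_distrib)

lemma ad_op_0: "ad_op 0 = 0"
  using ad_op_add[of 0 0] by simp

lemma ad_op_sum: "ad_op (sum f S) = (\<Sum>i\<in>S. ad_op (f i))"
  by (induction S rule: infinite_finite_induct) (simp_all add: ad_op_0 ad_op_add)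

lemma ad_op_diff: "ad_op (p - q) = ad_op p - ad_op q"
  using ad_op_add[of "p - q" q] by simp

lemma ad_op_scal: "ad_op (scal L (of_rat c) p) = scal_op c * ad_op p"
  by (rule endo_eqI)
    (simp add: app_ad_op app_scal_op brk_left_simps dif_simps vs.scale_right_diff_distrib vs.scale_left_commute)

lemma brk_Deg_0_derivation:
  assumes "p \<in> Deg L 0" "q \<in> Deg L 0"
  shows "brk L p (brk L q x) = brk L (brk L p q) x + brk L q (brk L p x)"
proof (rule homogeneous_eqI[where f = "\<lambda>x. brk L p (brk L q x)"])
  fix n x assume "x \<in> Deg L n"
  then show "brk L p (brk L q x) = brk L (brk L p q) x + brk L q (brk L p x)"
    using Jacobi[OF assms] by simp
qed (simp_all add: brk_right_simps)

text \<open>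
  On \<open>x\<close> this is the Jacobi identity, and on \<open>d\<close> it is the Leibniz rule for \<open>\<delta> [p, q]\<close>.
\<close>

lemma comm_ad_op:
  assumes "p \<in> Deg L 0" "q \<in> Deg L 0"
  shows "comm (ad_op p) (ad_op q) = ad_op (brk L p q)"
proof (rule endo_eqI)
  fix x c
  have "brk L (dif L p) q = - brk L q (dif L p)"
    using brk_antisym[OF dif_Deg[OF assms(1)] assms(2)] by simp
  then have "dif L (brk L p q) = brk L p (dif L q) - brk L q (dif L p)"
    using Leibniz[OF assms] by simp
  then show "app (comm (ad_op p) (ad_op q)) (x, c) = app (ad_op (brk L p q)) (x, c)"
    using brk_Deg_0_derivation[OF assms, of x]
    by (simp add: comm_def app_ad_op brk_right_simps vs.scale_right_diff_distrib)
qed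

lemma nested_brk_Deg_0: "set w \<subseteq> Deg L 0 \<Longrightarrow> nested_brk L w \<in> Deg L 0"
proof (induction w rule: induct_list012)
  case 1
  then show ?case using vs.subspace_0[OF Deg_subspace] by simp
next
  case (3 x y zs)
  then show ?case using brk_Deg[of x 0 "nested_brk L (y # zs)" 0] by simp
qed simp

lemma nested_brk_Fil: "w \<noteq> [] \<Longrightarrow> nested_brk L w \<in> Fil L (length w)"
proof (induction w rule: induct_list012)
  case (3 x y zs)
  then show ?case using brk_Fil[of 1 "length (y # zs)" x "nested_brk L (y # zs)"] by simp
qed simp_all

lemma nested_comm_ad_op: "set w \<subseteq> Deg L 0 \<Longrightarrow> nested_comm (map ad_op w) = ad_op (nested_brk L w)"
proof (induction w rule: induct_list012)
  case (3 x y zs)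
  then show ?case
    using comm_ad_op[of x "nested_brk L (y # zs)"] nested_brk_Deg_0[of "y # zs"] by simp
qed (simp_all add: ad_op_0)

text \<open>
  The element \<open>d\<close> is placed in filtration 0 only. As \<open>\<delta>p\<close> lies in \<open>Fil L (n + 1)\<close> for \<open>p\<close> in
  \<open>Fil L n\<close>, the operator \<open>ad_op p\<close> still raises this filtration by \<open>n\<close>.
\<close>

definition ext_Fil :: "nat \<Rightarrow> ('g \<times> 'k) set" where
  "ext_Fil r = (if r = 0 then UNIV else Fil L r \<times> {0})"

lemma ext_Fil_diff: "v \<in> ext_Fil r \<Longrightarrow> w \<in> ext_Fil r \<Longrightarrow> v - w \<in> ext_Fil r"
  using vs.subspace_diff[OF Fil_subspace[of r]] by (auto simp: ext_Fil_def split: if_splits)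

lemma ext_Fil_0: "0 \<in> ext_Fil r"
  using vs.subspace_0[OF Fil_subspace[of r]] by (auto simp: ext_Fil_def zero_prod_def)

lemma ext_Fil_add: "v \<in> ext_Fil r \<Longrightarrow> w \<in> ext_Fil r \<Longrightarrow> v + w \<in> ext_Fil r"
  using ext_Fil_diff[of v r "0 - w"] ext_Fil_diff[of 0 r w] ext_Fil_0 by simp

lemma ext_Fil_diff_commute: "v - w \<in> ext_Fil r \<Longrightarrow> w - v \<in> ext_Fil r"
  using ext_Fil_diff[OF ext_Fil_0, of "v - w" r] by simp

lemma ext_Fil_diff_trans: "u - v \<in> ext_Fil r \<Longrightarrow> v - w \<in> ext_Fil r \<Longrightarrow> u - w \<in> ext_Fil r"
  using ext_Fil_add[of "u - v" r "v - w"] by simp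

lemma ext_Fil_Suc: "ext_Fil (Suc r) \<subseteq> ext_Fil r"
  using Fil_decreasing[of r] by (auto simp: ext_Fil_def)

definition op_Fil :: "nat \<Rightarrow> ('g \<times> 'k) endo set" where
  "op_Fil n = {a. \<forall>r. \<forall>v\<in>ext_Fil r. app a v \<in> ext_Fil (r + n)}"

lemma op_FilD: "a \<in> op_Fil n \<Longrightarrow> v \<in> ext_Fil r \<Longrightarrow> app a v \<in> ext_Fil (r + n)"
  by (simp add: op_Fil_def)

sublocale ops: filtered_rat_algebra scal_op op_Fil
proof
  show "scal_op 1 = 1" by (rule endo_eqI) (simp add: app_scal_op)
  show "scal_op (a + b) = scal_op a + scal_op b" for a b
    by (rule endo_eqI) (simp add: app_scal_op of_rat_add vs.scale_left_distrib distrib_right)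
  show "scal_op (a * b) = scal_op a * scal_op b" for a b
    by (rule endo_eqI) (simp add: app_scal_op of_rat_mult)
  show "0 \<in> op_Fil n" for n by (simp add: op_Fil_def ext_Fil_0)
  show "a - b \<in> op_Fil n" if "a \<in> op_Fil n" "b \<in> op_Fil n" for a b n
    using that by (simp add: op_Fil_def ext_Fil_diff)
  show "a * b \<in> op_Fil (m + n)" if "a \<in> op_Fil m" "b \<in> op_Fil n" for a b m n
    unfolding op_Fil_def using op_FilD[OF that(1) op_FilD[OF that(2)]] by (simp add: ac_simps)
  show "scal_op c \<in> op_Fil 0" for c
    using vs.subspace_scale[OF Fil_subspace] by (auto simp: op_Fil_def ext_Fil_def app_scal_op)
  show "op_Fil (Suc n) \<subseteq> op_Fil n" for n
    using ext_Fil_Suc by (auto simp: op_Fil_def)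
qed

lemma ad_op_in_op_Fil:
  assumes "n \<ge> 1" "p \<in> Fil L n"
  shows "ad_op p \<in> op_Fil n"
  unfolding op_Fil_def
proof (intro CollectI allI ballI)
  fix r and v :: "'g \<times> 'k"
  assume v: "v \<in> ext_Fil r"
  obtain x c where xc: "v = (x, c)" by force
  show "app (ad_op p) v \<in> ext_Fil (r + n)"
  proof (cases r)
    case 0
    have "brk L p x \<in> Fil L (n + 1)"
      using assms by (intro brk_Fil) auto
    moreover have "scal L c (dif L p) \<in> Fil L (n + 1)"
      using assms dif_Fil[of n p] by (intro vs.subspace_scale Fil_subspace) auto
    ultimately have "brk L p x - scal L c (dif L p) \<in> Fil L (n + 1)"
      by (intro vs.subspace_diff Fil_subspace) auto
    then show ?thesis using 0 assms(1) Fil_decreasing[of n] by (auto simp: xc app_ad_op ext_Fil_def)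
  next
    case (Suc m)
    then have "x \<in> Fil L r" "c = 0" using v by (auto simp: xc ext_Fil_def)
    then show ?thesis
      using assms Suc brk_Fil[of n r p x] by (simp add: xc app_ad_op ext_Fil_def add.commute)
  qed
qed

lemma ad_op_in_op_Fil_1: "ad_op p \<in> op_Fil 1"
  by (rule ad_op_in_op_Fil) simp_all

lemma of_rat_fact: "of_rat (fact n) = (fact n :: 'k)"
  using of_rat_of_nat_eq[of "fact n"] by simp

lemma dynkin_part_ad_op:
  assumes "p \<in> Deg L 0" "q \<in> Deg L 0"
  shows "ops.dynkin_part (ad_op p) (ad_op q) n = ad_op (bch_part L p q n)"
  unfolding ops.dynkin_part_def bch_part_def ad_op_sum
proof (rule sum.cong[OF refl])
  fix rs
  have "of_rat (\<Prod>(r, s)\<leftarrow>rs. fact r * fact s) = (\<Prod>(r, s)\<leftarrow>rs. fact r * fact s :: 'k)"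
    by (induction rs) (auto simp: of_rat_mult of_rat_fact)
  then have coeff: "(-1) ^ (length rs + 1) / (of_nat (length rs) * of_nat n * (\<Prod>(r, s)\<leftarrow>rs. fact r * fact s))
      = (of_rat ((-1) ^ (length rs + 1) / (of_nat (length rs) * of_nat n * (\<Prod>(r, s)\<leftarrow>rs. fact r * fact s))) :: 'k)"
    by (simp add: of_rat_divide of_rat_mult of_rat_power of_rat_minus)
  have "dynkin_word (ad_op p) (ad_op q) rs = map ad_op (dynkin_word p q rs)"
    by (simp add: dynkin_word_def map_concat comp_def case_prod_unfold)
  moreover have "set (dynkin_word p q rs) \<subseteq> Deg L 0"
    using set_dynkin_word[of p q rs] assms by blast
  ultimately show "scal_op ((-1) ^ (length rs + 1) / (of_nat (length rs) * of_nat n * (\<Prod>(r, s)\<leftarrow>rs. fact r * fact s)))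
      * nested_comm (dynkin_word (ad_op p) (ad_op q) rs)
    = ad_op (scal L ((-1) ^ (length rs + 1) / (of_nat (length rs) * of_nat n * (\<Prod>(r, s)\<leftarrow>rs. fact r * fact s)))
        (nested_brk L (dynkin_word p q rs)))"
    unfolding coeff ad_op_scal by (simp add: nested_comm_ad_op)
qed

lemma bch_part_FD:
  assumes "p \<in> Deg L 0" "q \<in> Deg L 0"
  shows "bch_part L p q (Suc n) \<in> FD L (Suc n) 0"
  unfolding bch_part_def
proof (intro vs.subspace_sum vs.subspace_scale FD_subspace)
  fix rs assume rs: "rs \<in> dynkin_index (Suc n)"
  have "length (dynkin_word p q rs) = Suc n"
    using rs by (rule length_dynkin_word)
  moreover from this have "dynkin_word p q rs \<noteq> []" by auto
  moreover have "set (dynkin_word p q rs) \<subseteq> Deg L 0"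
    using set_dynkin_word[of p q rs] assms by blast
  ultimately show "nested_brk L (dynkin_word p q rs) \<in> FD L (Suc n) 0"
    using nested_brk_Fil[of "dynkin_word p q rs"] nested_brk_Deg_0 by (simp add: FD_def)
qed simp_all

lemma bch_Deg_0: "p \<in> Deg L 0 \<Longrightarrow> q \<in> Deg L 0 \<Longrightarrow> bch L p q \<in> Deg L 0"
  unfolding bch_def by (rule fil_suminf_approx(1)) (rule bch_part_FD)

text \<open>
  Dynkin's formula for the operators \<open>ad_op p\<close> and \<open>ad_op q\<close>: the operator \<open>ad_op (bch L p q)\<close>
  agrees with the partial sums of their Dynkin series, because \<open>ad_op\<close> maps \<open>bch_part\<close> to
  \<open>dynkin_part\<close> and raises the filtration by at least as much as its argument is deep.
\<close>

lemma texp_ad_op_bch: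
  assumes "p \<in> Deg L 0" "q \<in> Deg L 0"
  shows "ops.texp (Suc N) (ad_op (bch L p q)) - ops.texp (Suc N) (ad_op p) * ops.texp (Suc N) (ad_op q)
    \<in> op_Fil (Suc N)"
proof (rule ops.texp_dynkin)
  have "(\<Sum>n<N. bch_part L p q (Suc n)) - bch L p q \<in> Fil L (Suc N)"
    unfolding bch_def by (rule fil_suminf_approx(2)) (rule bch_part_FD[OF assms])
  then have "bch L p q - (\<Sum>n<N. bch_part L p q (Suc n)) \<in> Fil L (Suc N)"
    using vs.subspace_neg[OF Fil_subspace[of "Suc N"]] by fastforce
  then have "ad_op (bch L p q - (\<Sum>n<N. bch_part L p q (Suc n))) \<in> op_Fil (Suc N)"
    by (rule ad_op_in_op_Fil[rotated]) simp
  then show "ad_op (bch L p q) - (\<Sum>n<N. ops.dynkin_part (ad_op p) (ad_op q) (Suc n)) \<in> op_Fil (Suc N)"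
    by (simp add: ad_op_diff ad_op_sum dynkin_part_ad_op[OF assms])
  show "ad_op (bch L p q) \<in> op_Fil 0"
    using ops.J_mono[OF le0 ad_op_in_op_Fil_1] .
qed (rule ad_op_in_op_Fil_1)+

section \<open>The gauge action\<close>

lemma brk_pow_FD:
  assumes "p \<in> Deg L 0" "x \<in> FD L r n" "r \<ge> 1"
  shows "(brk L p ^^ j) x \<in> FD L (r + j) n"
proof (induction j)
  case (Suc j)
  then show ?case
    using assms brk_Deg[of p 0 "(brk L p ^^ j) x" n] brk_Fil[of 1 "r + j" p "(brk L p ^^ j) x"]
    by (simp add: FD_def)
qed (use assms in simp)

text \<open>
  The second part says \<open>exp (ad p) (x + d) = \<Gamma> p x + d\<close> up to the truncation. The powers of
  \<open>ad_op p\<close> on \<open>d\<close> start with \<open>- \<delta>p\<close>, which shifts the index of the second series by one and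
  explains its coefficients \<open>1 / (j + 1)!\<close>.
\<close>

lemma gauge_approx:
  assumes p: "p \<in> Deg L 0" and x: "x \<in> Deg L 1"
  shows "gauge L p x \<in> Deg L 1"
    and "app (ops.texp (Suc N) (ad_op p)) (x, 1) - (gauge L p x, 1) \<in> ext_Fil (Suc N)"
proof -
  let ?a = "\<lambda>j. scal L (1 / fact j) ((brk L p ^^ j) x)"
  let ?b = "\<lambda>j. scal L (1 / fact (j + 1)) ((brk L p ^^ j) (dif L p))"
  have a: "?a j \<in> FD L (Suc j) 1" for j
    using brk_pow_FD[OF p, of x 1 1 j] x by (intro vs.subspace_scale FD_subspace) (auto simp: FD_def)
  have b2: "?b j \<in> FD L (Suc (Suc j)) 1" for j
    using brk_pow_FD[OF p, of "dif L p" 2 1 j] dif_Fil[of 1 p] dif_Deg[OF p]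
    by (intro vs.subspace_scale FD_subspace) (auto simp: FD_def numeral_2_eq_2)
  then have b: "?b j \<in> FD L (Suc j) 1" for j
    using Fil_decreasing[of "Suc j"] by (auto simp: FD_def)
  show "gauge L p x \<in> Deg L 1"
    unfolding gauge_def using fil_suminf_approx(1)[OF a] fil_suminf_approx(1)[OF b]
    by (rule vs.subspace_diff[OF Deg_subspace])
  have pow: "(app (ad_op p) ^^ Suc n) (x, 1) = ((brk L p ^^ Suc n) x - (brk L p ^^ n) (dif L p), 0)" for n
    by (induction n) (simp_all add: app_ad_op brk_right_simps)
  have "app (ops.texp (Suc N) (ad_op p)) (x, 1)
      = (x, 1) + (\<Sum>n<N. (?a (Suc n) - ?b n, 0))"
    unfolding ops.texp_def app_sum
    by (subst sum.lessThan_Suc_shift)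
      (simp add: app_power pow app_scal_op vs.scale_right_diff_distrib of_rat_divide of_rat_fact del: funpow.simps fact_Suc power_Suc)
  also have "\<dots> = ((\<Sum>j<Suc N. ?a j) - (\<Sum>j<N. ?b j), 1)"
    by (subst sum.lessThan_Suc_shift) (simp add: sum_prod sum_subtractf)
  finally have *: "app (ops.texp (Suc N) (ad_op p)) (x, 1) = ((\<Sum>j<Suc N. ?a j) - (\<Sum>j<N. ?b j), 1)" .
  have "(\<Sum>j<Suc N. ?a j) - fil_suminf L ?a \<in> Fil L (Suc N)"
    using fil_suminf_approx(2)[OF a, of "Suc N"] Fil_decreasing[of "Suc N"] by auto
  then have "((\<Sum>j<Suc N. ?a j) - fil_suminf L ?a) - ((\<Sum>j<N. ?b j) - fil_suminf L ?b) \<in> Fil L (Suc N)"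
    using fil_suminf_approx(2)[OF b, of N] by (rule vs.subspace_diff[OF Fil_subspace, rotated]) simp
  then show "app (ops.texp (Suc N) (ad_op p)) (x, 1) - (gauge L p x, 1) \<in> ext_Fil (Suc N)"
    unfolding * by (simp add: gauge_def ext_Fil_def algebra_simps)
qed

text \<open>
  On \<open>x + d\<close> the two sides are \<open>exp (ad (q * p))\<close> and \<open>exp (ad q) exp (ad p)\<close>, which agree modulo
  every filtration step; operators that preserve the filtration respect the truncation error of
  the inner one.
\<close>

theorem gauge_bch:
  assumes p: "p \<in> Deg L 0" and q: "q \<in> Deg L 0" and x: "x \<in> Deg L 1"
  shows "gauge L (bch L q p) x = gauge L q (gauge L p x)"
proof -
  let ?y = "gauge L (bch L q p) x" and ?z = "gauge L q (gauge L p x)"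
  have "?y - ?z \<in> Fil L r" if r: "r \<ge> 1" for r
  proof -
    obtain N where N: "r = Suc N" using r by (cases r) auto
    let ?e = "\<lambda>p. app (ops.texp r (ad_op p))"
    have "?e (bch L q p) (x, 1) - (?y, 1) \<in> ext_Fil r"
      unfolding N by (rule gauge_approx(2)) (simp_all add: bch_Deg_0 p q x)
    moreover have "?e (bch L q p) (x, 1) - ?e q (?e p (x, 1)) \<in> ext_Fil r"
      using op_FilD[OF texp_ad_op_bch[OF q p, of N], of "(x, 1)" 0] by (simp add: N ext_Fil_def)
    moreover have "?e q (?e p (x, 1)) - ?e q (gauge L p x, 1) \<in> ext_Fil r"
      using op_FilD[OF ops.texp_in_J_0[OF ad_op_in_op_Fil_1] gauge_approx(2)[OF p x, of N], of r q]
      by (simp add: N app_diff)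
    moreover have "?e q (gauge L p x, 1) - (?z, 1) \<in> ext_Fil r"
      unfolding N by (intro gauge_approx p q x)
    ultimately have "(?y, 1) - (?z, 1) \<in> ext_Fil r"
      by (meson ext_Fil_diff_commute ext_Fil_diff_trans)
    then show ?thesis using r by (simp add: ext_Fil_def)
  qed
  then have "?y - ?z = 0" by (rule Inter_Fil)
  then show ?thesis by simp
qed

text \<open>
  The difference is \<open>(exp (ad p) - 1) u\<close>, and \<open>ad p\<close> raises the filtration by one.
\<close>

lemma gauge_add:
  assumes p: "p \<in> Deg L 0" and x: "x \<in> Deg L 1" and u: "u \<in> FD L r 1" and r: "r \<ge> 1"
  shows "gauge L p (x + u) - gauge L p x - u \<in> Fil L (Suc r)"
proof -
  let ?e = "app (ops.texp (Suc r) (ad_op p))"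
  have "x + u \<in> Deg L 1"
    using x u vs.subspace_add[OF Deg_subspace] by (simp add: FD_def)
  then have "?e (x + u, 1) - (gauge L p (x + u), 1) \<in> ext_Fil (Suc r)"
    by (rule gauge_approx(2)[OF p])
  moreover have "?e (x, 1) - (gauge L p x, 1) \<in> ext_Fil (Suc r)"
    by (rule gauge_approx(2)[OF p x])
  moreover have "?e (u, 0) - (u, 0) \<in> ext_Fil (Suc r)"
    using op_FilD[OF ops.texp_minus_1[OF ad_op_in_op_Fil_1], of "(u, 0)" r r p] u r
    by (simp add: ext_Fil_def FD_def)
  moreover have "?e (x + u, 1) = ?e (x, 1) + ?e (u, 0)"
    by (simp flip: app_add)
  ultimately have "?e (x + u, 1) - (gauge L p (x + u), 1) \<in> ext_Fil (Suc r)"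
    "?e (x + u, 1) - ((gauge L p x, 1) + (u, 0)) \<in> ext_Fil (Suc r)"
    using ext_Fil_add[of "?e (x, 1) - (gauge L p x, 1)" "Suc r" "?e (u, 0) - (u, 0)"]
    by (simp_all only: add_diff_add)
  then have "(gauge L p (x + u), 1) - ((gauge L p x, 1) + (u, 0)) \<in> ext_Fil (Suc r)"
    by (meson ext_Fil_diff_commute ext_Fil_diff_trans)
  then show ?thesis by (simp add: ext_Fil_def algebra_simps)
qed

lemma gr_class_eq_iff: "gr_class L r x = gr_class L r y \<longleftrightarrow> x - y \<in> Fil L (Suc r)"
  unfolding gr_class_def using coset_eq_iff[OF Fil_subspace[of "Suc r"]] by simp

lemma gr_class_add: "gr_class L r x + gr_class L r y = gr_class L r (x + y)"
proof -
  have "Fil L (r + 1) + Fil L (r + 1) = Fil L (r + 1)"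
    using coset_plus_subspace[OF Fil_subspace[of "r + 1"] subset_refl vs.subspace_0[OF Fil_subspace], of 0]
    by simp
  then show ?thesis by (simp add: gr_class_def set_plus_rearrange)
qed

end

theorem proposition4p15:
  fixes L :: "('k::field_char_0, 'g::ab_group_add) filtered_dgla"
    and k :: nat and m0 m1 m2 p q :: 'g
  assumes "complete_filtered_dgla L"
    and "k \<ge> 4"
    and "m0 \<in> FD L 2 1 \<inter> maurer_cartan L"
    and "m1 \<in> FD L 2 1 \<inter> maurer_cartan L"
    and "m2 \<in> FD L 2 1 \<inter> maurer_cartan L"
    and "p \<in> PP L (k - 1) m0 m1"
    and "q \<in> PP L (k - 1) m1 m2"
  shows "(\<forall>x \<in> Deg L 1. gauge L (bch L q p) x = gauge L q (gauge L p x))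
    \<and> bch L q p \<in> PP L (k - 1) m0 m2
    \<and> {kappa L k (bch L q p) m0 m2, kappa L k p m0 m1, kappa L k q m1 m2} \<subseteq> gr L (k - 1) 1
    \<and> kappa L k (bch L q p) m0 m2 = kappa L k p m0 m1 + kappa L k q m1 m2"
proof -
  interpret complete_filtered_dgla L by fact
  have Deg: "p \<in> Deg L 0" "q \<in> Deg L 0" "m0 \<in> Deg L 1" "m1 \<in> Deg L 1" "m2 \<in> Deg L 1"
    using assms by (auto simp: PP_def FD_def)
  define r where "r = k - 1"
  have r: "r \<ge> 1" "k = Suc r" using assms(2) by (auto simp: r_def)
  define u where "u = gauge L p m0 - m1"
  define v where "v = gauge L q m1 - m2"
  define w where "w = gauge L (bch L q p) m0 - m2"
  have b: "bch L q p \<in> Deg L 0" by (rule bch_Deg_0[OF Deg(2,1)])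
  have diff: "gauge L s x - y \<in> Deg L 1" if "s \<in> Deg L 0" "x \<in> Deg L 1" "y \<in> Deg L 1" for s x y
    using gauge_approx(1)[OF that(1,2)] that(3) by (rule vs.subspace_diff[OF Deg_subspace])
  have u: "u \<in> FD L r 1" and v: "v \<in> FD L r 1"
    using assms(6,7) diff Deg by (auto simp: PP_def FD_def u_def v_def r_def)
  have comp: "\<forall>x \<in> Deg L 1. gauge L (bch L q p) x = gauge L q (gauge L p x)"
    using gauge_bch[OF Deg(1,2)] by blast
  \<comment> \<open>\<open>m1 + u\<close> is \<open>gauge L p m0\<close>, so this compares \<open>w\<close> with \<open>u + v\<close>\<close>
  have "gauge L q (m1 + u) - gauge L q m1 - u \<in> Fil L (Suc r)"
    by (rule gauge_add[OF Deg(2,4) u r(1)])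
  moreover have "gauge L q (m1 + u) = gauge L (bch L q p) m0"
    using comp Deg(3) by (simp add: u_def)
  ultimately have wuv: "w - (u + v) \<in> Fil L (Suc r)"
    by (simp add: w_def v_def algebra_simps)
  then have "w - (u + v) \<in> Fil L r" using Fil_decreasing[OF r(1)] by blast
  then have "w - (u + v) + (u + v) \<in> Fil L r"
    using u v by (intro vs.subspace_add Fil_subspace r) (auto simp: FD_def)
  then have w: "w \<in> FD L r 1"
    using diff[OF b Deg(3,5)] by (simp add: FD_def w_def)
  have kappa: "kappa L k (bch L q p) m0 m2 = gr_class L r w"
    "kappa L k p m0 m1 = gr_class L r u" "kappa L k q m1 m2 = gr_class L r v"
    by (simp_all add: kappa_def r_def u_def v_def w_def)
  have "gr_class L r w = gr_class L r u + gr_class L r v"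
    using wuv by (simp add: gr_class_add gr_class_eq_iff)
  moreover have "bch L q p \<in> PP L r m0 m2"
    using w b by (simp add: PP_def FD_def w_def)
  ultimately show ?thesis
    using comp u v w unfolding kappa by (auto simp: gr_def r_def)
qed

end
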